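(* Let $P\subset\mathbb{R}^2$ be a finite set of points in convex position, and let $T_I$ and $T_F$ be any two plane spanning trees of $P$. (1) There exists a shortest flip sequence from $T_I$ to $T_F$ such that any convex hull edge is flipped at most once; that is, for every tree $T_i$ of the sequence $T_I=T_0,\dots,T_k=T_F$ and every convex hull edge $h\in T_i$, the trace of $h$ on the remaining sequence $T_i,\dots,T_k$ has length at most $1$. (2) In the compatible case (only compatible flips are allowed), there exists a shortest compatible flip sequence from $T_I$ to $T_F$ in which every edge is flipped at most twice; that is, every $e\in T_I$ has trace of length at most $2$.
   Context: Edges are straight-line segments $uv$ between distinct points $u,v\in P$. A convex hull edge joins two points adjacent on the boundary of the convex hull of $P$. Two edges cross if their segments meet in a point other than a common endpoint. A plane spanning tree of $P$ ($|P|=n$) is a set of $n-1$ pairwise non-crossing edges forming a tree on the vertex set $P$. A flip $e\to f$ in a plane spanning tree $T$ removes an edge $e\in T$ and adds an edge $f\notin T$ such that $T-e+f$ is again a plane spanning tree of $P$. The flip is compatible if $e$ and $f$ do not cross (they are disjoint or share an endpoint). A flip sequence from $T_I$ to $T_F$ is a sequence of plane spanning trees $T_I=T_0,T_1,\dots,T_k=T_F$ in which consecutive trees differ by a single flip; its length is $k$; it is shortest if $k$ is minimum among all flip sequences from $T_I$ to $T_F$. A compatible flip sequence is one all of whose flips are compatible, and a shortest compatible flip sequence is one of minimum length among compatible flip sequences from $T_I$ to $T_F$. The trace of an edge $e\in T_0$ in a flip sequence $T_0,\dots,T_k$ is the tuple of successive positions to which $e$ is flipped, defined recursively: it is $(e)$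 if $k=0$; it equals the trace of $e$ in $T_1,\dots,T_k$ if $e\in T_0\cap T_1$; and it is $(e)$ followed by the trace of $f$ in $T_1,\dots,T_k$ if the first flip is $e\to f$. The length of a trace is its number of entries minus one, i.e. its number of flips. *)

theory Defs
  imports "HOL-Analysis.Analysis"
begin

type_synonym point = "real^2"

text \<open>An edge is the set of its two end points; its segment is the convex hull of
  that set (see \<open>segment_convex_hull\<close>).\<close>

type_synonym edge = "point set"

definition convex_position :: "point set \<Rightarrow> bool" where
  "convex_position P \<longleftrightarrow> (\<forall>p\<in>P. p extreme_point_of (convex hull P))"

definition edges_on :: "point set \<Rightarrow> edge set" where
  "edges_on P = {{u, v} |u v. u \<in> P \<and> v \<in> P \<and> u \<noteq> v}"

definition hull_edge :: "point set \<Rightarrow> edge \<Rightarrow> bool" where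
  "hull_edge P h \<longleftrightarrow> h \<in> edges_on P \<and> (convex hull h) edge_of (convex hull P)"

text \<open>The common end points of \<open>e\<close> and \<open>f\<close> are the elements of \<open>e \<inter> f\<close>.\<close>

definition crossing :: "edge \<Rightarrow> edge \<Rightarrow> bool" where
  "crossing e f \<longleftrightarrow> e \<noteq> f \<and> (\<exists>x \<in> convex hull e \<inter> convex hull f. x \<notin> e \<inter> f)"

definition connected_graph :: "point set \<Rightarrow> edge set \<Rightarrow> bool" where
  "connected_graph V E \<longleftrightarrow> (\<forall>u\<in>V. \<forall>v\<in>V. (u, v) \<in> {(x, y). {x, y} \<in> E}\<^sup>*)"

definition graph_cycle :: "edge set \<Rightarrow> point list \<Rightarrow> bool" where
  "graph_cycle E vs \<longleftrightarrow> 3 \<le> length vs \<and> distinct vs \<and>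
     (\<forall>i < length vs. {vs ! i, vs ! (Suc i mod length vs)} \<in> E)"

definition tree_on :: "point set \<Rightarrow> edge set \<Rightarrow> bool" where
  "tree_on V E \<longleftrightarrow> V \<noteq> {} \<and> E \<subseteq> edges_on V \<and> connected_graph V E \<and> (\<nexists>vs. graph_cycle E vs)"

definition plane_spanning_tree :: "point set \<Rightarrow> edge set \<Rightarrow> bool" where
  "plane_spanning_tree P T \<longleftrightarrow>
     tree_on P T \<and> card T = card P - 1 \<and> (\<forall>e\<in>T. \<forall>f\<in>T. \<not> crossing e f)"

definition flip :: "point set \<Rightarrow> edge \<Rightarrow> edge \<Rightarrow> edge set \<Rightarrow> edge set \<Rightarrow> bool" where
  "flip P e f T T' \<longleftrightarrow> plane_spanning_tree P T \<and> e \<in> T \<and> f \<notin> T \<and>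
     T' = insert f (T - {e}) \<and> plane_spanning_tree P T'"

definition compatible_flip :: "point set \<Rightarrow> edge \<Rightarrow> edge \<Rightarrow> edge set \<Rightarrow> edge set \<Rightarrow> bool" where
  "compatible_flip P e f T T' \<longleftrightarrow> flip P e f T T' \<and> \<not> crossing e f"

text \<open>Sequences are given by their list of trees \<open>[T\<^sub>0, \<dots>, T\<^sub>k]\<close>.\<close>

definition flip_sequence :: "point set \<Rightarrow> edge set \<Rightarrow> edge set \<Rightarrow> edge set list \<Rightarrow> bool" where
  "flip_sequence P TI TF Ts \<longleftrightarrow>
     Ts \<noteq> [] \<and> hd Ts = TI \<and> last Ts = TF \<and> (\<forall>T \<in> set Ts. plane_spanning_tree P T) \<and>
     successively (\<lambda>T T'. \<exists>e f. flip P e f T T') Ts"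

definition compatible_flip_sequence ::
    "point set \<Rightarrow> edge set \<Rightarrow> edge set \<Rightarrow> edge set list \<Rightarrow> bool" where
  "compatible_flip_sequence P TI TF Ts \<longleftrightarrow>
     flip_sequence P TI TF Ts \<and> successively (\<lambda>T T'. \<exists>e f. compatible_flip P e f T T') Ts"

definition seq_length :: "edge set list \<Rightarrow> nat" where
  "seq_length Ts = length Ts - 1"

definition shortest_flip_sequence ::
    "point set \<Rightarrow> edge set \<Rightarrow> edge set \<Rightarrow> edge set list \<Rightarrow> bool" where
  "shortest_flip_sequence P TI TF Ts \<longleftrightarrow> is_arg_min seq_length (flip_sequence P TI TF) Ts"

definition shortest_compatible_flip_sequence ::
    "point set \<Rightarrow> edge set \<Rightarrow> edge set \<Rightarrow> edge set list \<Rightarrow> bool" where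
  "shortest_compatible_flip_sequence P TI TF Ts \<longleftrightarrow>
     is_arg_min seq_length (compatible_flip_sequence P TI TF) Ts"

text \<open>A flip is determined by the two trees, so a list of trees suffices to define traces.\<close>

lemma flip_edges:
  assumes "flip P e f T T'"
  shows "T - T' = {e}" and "T' - T = {f}"
  using assms by (auto simp: flip_def)

text \<open>In the last case \<open>e\<close> is the edge removed by the first flip, and
  \<open>the_elem (T' - T)\<close> is the edge added. Only used for \<open>e\<close> in the first tree.\<close>

fun trace :: "edge set list \<Rightarrow> edge \<Rightarrow> edge list" where
  "trace [] e = [e]"
| "trace [T] e = [e]"
| "trace (T # T' # Ts) e =
     (if e \<in> T' then trace (T' # Ts) e else e # trace (T' # Ts) (the_elem (T' - T)))"

definition trace_length :: "edge set list \<Rightarrow> edge \<Rightarrow> nat" where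
  "trace_length Ts e = length (trace Ts e) - 1"

end

theory Submission
  imports Defs
begin

text \<open>Choose a shortest flip sequence step by step from the end and repair each flip that violates the
  claim without changing the length.

  A flip \<open>h \<rightarrow> f\<close> of a hull edge \<open>h\<close> with \<open>f\<close> removed later is repaired by keeping \<open>h\<close> in place of
  \<open>f\<close>: since \<open>h\<close> crosses nothing, this works until a flip \<open>a \<rightarrow> b\<close> closes a cycle through \<open>h\<close>. If \<open>a\<close>
  is a hull edge, flip \<open>h \<rightarrow> b\<close> instead and let \<open>a\<close> stand in for \<open>f\<close> from then on; otherwise insert \<open>f\<close>
  at this time by \<open>a \<rightarrow> f\<close>, followed by \<open>h \<rightarrow> b\<close>. If \<open>f\<close> is removed before that, a flip is saved.

  In the compatible case, also a flip \<open>e \<rightarrow> f\<close> with \<open>f\<close> not a hull edge and removed later has to be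
  repaired. While \<open>f\<close> is present, the flips on its two sides commute. Those on the side not containing
  \<open>e\<close> can be done before \<open>e \<rightarrow> f\<close>; then a hull edge on that side stands in for \<open>f\<close>. So every intermediate
  position of an edge is a hull edge, which is flipped at most once.\<close>

section \<open>Spanning trees\<close>

definition linked :: "edge set \<Rightarrow> point \<Rightarrow> point \<Rightarrow> bool" where
  "linked E u v \<longleftrightarrow> (u, v) \<in> {(x, y). {x, y} \<in> E}\<^sup>*"

lemma linked_refl [simp, intro]: "linked E u u"
  by (simp add: linked_def)

lemma linked_edge: "{u, v} \<in> E \<Longrightarrow> linked E u v"
  by (auto simp: linked_def)

lemma linked_trans: "linked E u v \<Longrightarrow> linked E v w \<Longrightarrow> linked E u w"
  unfolding linked_def by (rule rtrancl_trans)

lemma linked_sym: "linked E u v \<Longrightarrow> linked E v u"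
proof -
  have "sym {(x, y). {x, y} \<in> E}" by (auto simp: sym_def insert_commute)
  then show "linked E u v \<Longrightarrow> linked E v u"
    unfolding linked_def by (meson sym_rtrancl symD)
qed

lemma linked_mono: "linked E u v \<Longrightarrow> E \<subseteq> F \<Longrightarrow> linked F u v"
proof -
  assume "E \<subseteq> F"
  then have "{(x, y). {x, y} \<in> E} \<subseteq> {(x, y). {x, y} \<in> F}" by auto
  then show "linked E u v \<Longrightarrow> linked F u v"
    unfolding linked_def using rtrancl_mono by blast
qed

lemma linked_induct [consumes 1, case_names refl step]:
  assumes "linked E u v" and "Q u"
    and "\<And>x y. linked E u x \<Longrightarrow> {x, y} \<in> E \<Longrightarrow> Q x \<Longrightarrow> Q y"
  shows "Q v"
  using assms(1) unfolding linked_def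
proof (induction rule: rtrancl_induct)
  case base
  then show ?case using assms(2) .
next
  case (step y z)
  then show ?case using assms(3) by (auto simp: linked_def)
qed

lemma connected_graph_linked: "connected_graph V E \<longleftrightarrow> (\<forall>u\<in>V. \<forall>v\<in>V. linked E u v)"
  by (simp add: connected_graph_def linked_def)

text \<open>Every use of the new edge can be replaced by a walk between its ends in
  \<open>E\<close>.\<close>

lemma linked_insert_linked:
  assumes "linked (insert {c, d} E) u v" and "linked E c d"
  shows "linked E u v"
  using assms(1)
proof (induction rule: linked_induct)
  case refl
  then show ?case by simp
next
  case (step x y)
  have "linked E x y"
  proof (cases "{x, y} \<in> E")
    case False
    then have "{x, y} = {c, d}" using step by simp
    then show ?thesis using assms(2) linked_sym by (auto simp: doubleton_eq_iff)
  qed (rule linked_edge)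
  then show ?case using step linked_trans by blast
qed

text \<open>After its last use of the removed edge, the walk continues from \<open>u\<close> or
  \<open>v\<close>.\<close>

lemma linked_remove:
  assumes "linked E w x"
  shows "linked (E - {{u, v}}) w x \<or> linked (E - {{u, v}}) u x \<or> linked (E - {{u, v}}) v x"
  using assms
proof (induction rule: linked_induct)
  case refl
  then show ?case by simp
next
  case (step x y)
  show ?case
  proof (cases "{x, y} = {u, v}")
    case True
    then show ?thesis by (auto simp: doubleton_eq_iff)
  next
    case False
    then have "linked (E - {{u, v}}) x y" using step by (auto intro: linked_edge)
    then show ?thesis using step linked_trans by blast
  qed
qed

text \<open>Without \<open>{u, v}\<close>, every vertex is still linked to \<open>u\<close> or to
  \<open>v\<close>. As \<open>c\<close> and \<open>d\<close> are not linked, one of them belongs to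
  \<open>u\<close> and the other to \<open>v\<close>, so the new edge links \<open>u\<close> and
  \<open>v\<close> again.\<close>

lemma connected_exchange:
  assumes "connected_graph V T" and "{u, v} \<subseteq> V" and "c \<in> V" and "d \<in> V"
    and "\<not> linked (T - {{u, v}}) c d"
  shows "connected_graph V (insert {c, d} (T - {{u, v}}))"
proof -
  let ?D = "T - {{u, v}}"
  let ?E = "insert {c, d} ?D"
  have uv: "linked ?D u x \<or> linked ?D v x" if "x \<in> V" for x
    using linked_remove[of T u x u v] assms(1,2) that by (auto simp: connected_graph_linked)
  have mono: "linked ?E x y" if "linked ?D x y" for x y
    using linked_mono[OF that] by blast
  have cd: "linked ?E c d" by (simp add: linked_edge)
  have "linked ?E u v"
    using uv[OF assms(3)] uv[OF assms(4)] assms(5) mono cd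
    by (meson linked_sym linked_trans)
  then have "linked ?E u x" if "x \<in> V" for x
    using uv[OF that] mono linked_trans by blast
  then show ?thesis
    unfolding connected_graph_linked by (meson linked_sym linked_trans)
qed

lemma connected_remove:
  assumes "connected_graph V E" and "linked (E - {{c, d}}) c d"
  shows "connected_graph V (E - {{c, d}})"
  unfolding connected_graph_linked
proof (intro ballI)
  fix u v assume "u \<in> V" "v \<in> V"
  then have "linked (insert {c, d} (E - {{c, d}})) u v"
    using assms(1) linked_mono[of E u v "insert {c, d} (E - {{c, d}})"]
    by (auto simp: connected_graph_linked)
  then show "linked (E - {{c, d}}) u v" using linked_insert_linked assms(2) by blast
qed

section \<open>Spanning trees by edge count\<close>

lemma edges_on_sub: "e \<in> edges_on P \<Longrightarrow> e \<subseteq> P"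
  by (auto simp: edges_on_def)

lemma finite_edges_on: "finite P \<Longrightarrow> finite (edges_on P)"
  by (rule finite_subset[of _ "Pow P"]) (auto simp: edges_on_def)

text \<open>Joining every vertex to its successor on a shortest path to a root is injective.\<close>

lemma connected_card:
  assumes "finite E" and "finite V" and "connected_graph V E" and "r \<in> V"
  shows "card V - 1 \<le> card E"
proof -
  define R where "R = {(x, y). {x, y} \<in> E}"
  define dist where "dist v = (LEAST n. (v, r) \<in> R ^^ n)" for v
  have reach: "\<exists>n. (v, r) \<in> R ^^ n" if "v \<in> V" for v
    using assms(3,4) that by (auto simp: connected_graph_def R_def[symmetric] rtrancl_power)
  have "\<exists>w. {v, w} \<in> E \<and> dist w < dist v" if "v \<in> V - {r}" for v
  proof -
    have *: "(v, r) \<in> R ^^ dist v"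
      unfolding dist_def using reach that by (meson DiffD1 LeastI_ex)
    with that obtain n where n: "dist v = Suc n" by (cases "dist v") auto
    with * obtain w where w: "(v, w) \<in> R" "(w, r) \<in> R ^^ n" using relpow_Suc_D2 by (metis)
    then have "dist w \<le> n" unfolding dist_def by (simp add: Least_le)
    then show ?thesis using w n by (auto simp: R_def)
  qed
  then obtain par where par: "\<And>v. v \<in> V - {r} \<Longrightarrow> {v, par v} \<in> E \<and> dist (par v) < dist v"
    by metis
  have "inj_on (\<lambda>v. {v, par v}) (V - {r})"
  proof (rule inj_onI)
    fix v w assume "v \<in> V - {r}" "w \<in> V - {r}" and eq: "{v, par v} = {w, par w}"
    \<comment> \<open>If the edges agree but \<open>v\<close> and \<open>w\<close> differ, each is
      the parent of the other and closer to the root than the other.\<close>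
    then have "dist (par v) < dist v" "dist (par w) < dist w" using par by auto
    with eq show "v = w" by (auto simp: doubleton_eq_iff)
  qed
  then have "card (V - {r}) \<le> card E"
    by (rule card_inj_on_le) (use par assms(1) in auto)
  then show ?thesis using assms(2,4) by simp
qed

text \<open>Connectedness together with the edge count is easy to check after an exchange;
  \<open>spanning_acyclic\<close> recovers the absence of cycles.\<close>

definition spanning :: "point set \<Rightarrow> edge set \<Rightarrow> bool" where
  "spanning P T \<longleftrightarrow> T \<subseteq> edges_on P \<and> connected_graph P T \<and> card T = card P - 1"

text \<open>Otherwise the remaining edges would connect \<open>P\<close> although they are one fewer
  than \<open>connected_card\<close> demands.\<close>

lemma spanning_remove:
  assumes "finite P" and "spanning P T" and "{c, d} \<in> T"
  shows "\<not> linked (T - {{c, d}}) c d"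
proof
  assume "linked (T - {{c, d}}) c d"
  then have con: "connected_graph P (T - {{c, d}})"
    using connected_remove assms(2) by (auto simp: spanning_def)
  have fin: "finite T" using assms(1,2) finite_edges_on finite_subset by (auto simp: spanning_def)
  have "c \<in> P" using assms(2,3) edges_on_sub by (auto simp: spanning_def)
  then have "card P - 1 \<le> card (T - {{c, d}})"
    using connected_card[OF _ assms(1) con] fin by blast
  moreover have "card T > 0" using fin assms(3) card_gt_0_iff by blast
  ultimately show False using assms(2,3) fin by (simp add: spanning_def)
qed

text \<open>The other edges of a cycle would link the ends of its closing edge
  \<open>{vs ! n, vs ! 0}\<close>, which \<open>spanning_remove\<close> forbids.\<close>

lemma spanning_acyclic:
  assumes "finite P" and "spanning P T"
  shows "\<not> graph_cycle T vs"
proof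
  assume cyc: "graph_cycle T vs"
  define n where "n = length vs - 1"
  have len: "length vs = Suc n" "2 \<le> n" using cyc by (auto simp: graph_cycle_def n_def)
  let ?e = "{vs ! n, vs ! 0}"
  have dist: "distinct vs" and edge: "\<And>i. i < length vs \<Longrightarrow> {vs ! i, vs ! (Suc i mod length vs)} \<in> T"
    using cyc by (auto simp: graph_cycle_def)
  have e: "?e \<in> T" using edge[of n] len by simp
  have "linked (T - {?e}) (vs ! 0) (vs ! i)" if "i \<le> n" for i
    using that
  proof (induction i)
    case (Suc i)
    have "{vs ! i, vs ! Suc i} \<in> T" using edge[of i] Suc len by simp
    moreover have "{vs ! i, vs ! Suc i} \<noteq> ?e"
      using Suc len dist by (auto simp: doubleton_eq_iff nth_eq_iff_index_eq)
    ultimately have "linked (T - {?e}) (vs ! i) (vs ! Suc i)" by (auto intro: linked_edge)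
    then show ?case using Suc linked_trans by (meson Suc_leD)
  qed simp
  then have "linked (T - {?e}) (vs ! n) (vs ! 0)" using linked_sym by blast
  then show False using spanning_remove[OF assms e] by simp
qed

lemma plane_spanning_tree_iff:
  assumes "finite P"
  shows "plane_spanning_tree P T \<longleftrightarrow>
    P \<noteq> {} \<and> spanning P T \<and> (\<forall>e\<in>T. \<forall>f\<in>T. \<not> crossing e f)"
  using spanning_acyclic[OF assms]
  by (auto simp: plane_spanning_tree_def tree_on_def spanning_def)

text \<open>Reduces an exchange to reachability: the new edge has to join the two components of
  \<open>T - {a}\<close>.\<close>

lemma spanning_exchange_iff:
  assumes "finite P" and "spanning P T" and "a \<in> T" and "{c, d} \<in> edges_on P" and "{c, d} \<notin> T"
  shows "spanning P (insert {c, d} (T - {a})) \<longleftrightarrow> \<not> linked (T - {a}) c d"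
proof -
  have fin: "finite T" using assms(1,2) finite_edges_on finite_subset by (auto simp: spanning_def)
  have "a \<in> edges_on P" using assms(2,3) by (auto simp: spanning_def)
  then obtain u v where a: "a = {u, v}" "u \<in> P" "v \<in> P" by (auto simp: edges_on_def)
  show ?thesis
  proof
    assume "spanning P (insert {c, d} (T - {a}))"
    from spanning_remove[OF assms(1) this, of c d]
    show "\<not> linked (T - {a}) c d" using assms(5) by simp
  next
    assume "\<not> linked (T - {a}) c d"
    then have "connected_graph P (insert {c, d} (T - {a}))"
      unfolding a(1) using connected_exchange[of P T u v c d] assms(2,4) a edges_on_sub
      by (auto simp: spanning_def)
    moreover have "card (insert {c, d} (T - {a})) = card T"
      using fin assms(3,5) card.remove[OF fin assms(3)] by simp
    ultimately show "spanning P (insert {c, d} (T - {a}))"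
      using assms(2,4) by (auto simp: spanning_def)
  qed
qed

text \<open>If \<open>T - a + e\<close> is not a tree, then \<open>T - a\<close> and \<open>T - a + e\<close> have the same components,
  so \<open>b\<close> still joins two components of \<open>T - f + e - a\<close>.\<close>

lemma spanning_double_exchange:
  assumes "finite P" and "spanning P T" and "a \<in> T" and "f \<in> T" and "a \<noteq> f"
    and "e \<notin> T" and "b \<notin> T" and "e \<noteq> b"
    and fe: "spanning P (insert e (T - {f}))" and ab: "spanning P (insert b (T - {a}))"
    and ae: "\<not> spanning P (insert e (T - {a}))"
  shows "spanning P (insert b (insert e (T - {f}) - {a}))"
proof -
  have ed: "e \<in> edges_on P" "b \<in> edges_on P" using fe ab by (auto simp: spanning_def)
  then obtain s t c d where e: "e = {s, t}" and b: "b = {c, d}" by (auto simp: edges_on_def)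
  have "\<not> linked (T - {a}) c d"
    using spanning_exchange_iff[OF assms(1,2,3)] ed ab assms(7) by (auto simp: b)
  moreover have "linked (T - {a}) s t"
    using spanning_exchange_iff[OF assms(1,2,3)] ed ae assms(6) by (auto simp: e)
  moreover have "linked (insert e (T - {a})) c d" if "linked (insert e (T - {f}) - {a}) c d"
    by (rule linked_mono[OF that]) auto
  ultimately have "\<not> linked (insert e (T - {f}) - {a}) c d"
    using linked_insert_linked[of s t "T - {a}" c d] unfolding e by auto
  then show ?thesis
    using spanning_exchange_iff[OF assms(1) fe, of a c d] assms ed b by auto
qed

text \<open>A walk can leave \<open>A\<close> only through \<open>p\<close> or \<open>q\<close> and
  can return only there, so an excursion is replaced by the edge \<open>{p, q}\<close>.\<close>

lemma linked_restrict:
  assumes "A \<inter> B = {p, q}" and "{p, q} \<in> E" and "\<forall>e\<in>E. e \<subseteq> A \<or> e \<subseteq> B"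
    and "linked E u w" and "u \<in> A" and "w \<in> A"
  shows "linked {e \<in> E. e \<subseteq> A} u w"
proof -
  let ?F = "{e \<in> E. e \<subseteq> A}"
  have pq: "linked ?F p q" "linked ?F q p" using assms(1,2) by (auto intro!: linked_edge simp: insert_commute)
  \<comment> \<open>Inside \<open>B\<close> the invariant only remembers that \<open>p\<close>, and
    with it \<open>q\<close>, can be reached within \<open>A\<close>.\<close>
  have "(w \<in> A \<longrightarrow> linked ?F u w) \<and> (w \<in> B \<longrightarrow> linked ?F u p)"
    using assms(4)
  proof (induction rule: linked_induct)
    case refl
    then show ?case using assms(1,5) pq by auto
  next
    case (step x y)
    have *: "z = p \<or> z = q" if "z \<in> A" "z \<in> B" for z using that assms(1) by blast
    consider "{x, y} \<subseteq> A" | "{x, y} \<subseteq> B" using assms(3) step(2) by auto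
    then show ?case
    proof cases
      case 1
      then have "linked ?F x y" using step(2) by (intro linked_edge) simp
      moreover have "linked ?F u x" using step(3) 1 by simp
      ultimately have uy: "linked ?F u y" by (rule linked_trans[rotated])
      moreover have "linked ?F u p" if "y \<in> B"
        using *[OF _ that] 1 uy linked_trans[OF uy] pq by auto
      ultimately show ?thesis by simp
    next
      case 2
      then have up: "linked ?F u p" using step(3) by simp
      moreover have "linked ?F u y" if "y \<in> A"
        using *[OF that] 2 up linked_trans[OF up] pq by auto
      ultimately show ?thesis by simp
    qed
  qed
  then show ?thesis using assms(6) by simp
qed

section \<open>Points in convex position\<close>

text \<open>Twice the signed area of the triangle \<open>p q r\<close>, positive if its corners are
  in counterclockwise order.\<close>

definition orient :: "point \<Rightarrow> point \<Rightarrow> point \<Rightarrow> real" where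
  "orient p q r = (q $ 1 - p $ 1) * (r $ 2 - p $ 2) - (q $ 2 - p $ 2) * (r $ 1 - p $ 1)"

lemma orient_swap: "orient q p r = - orient p q r"
  by (simp add: orient_def algebra_simps)

lemma orient_rotate: "orient q r p = orient p q r"
  by (simp add: orient_def algebra_simps)

lemma orient_same [simp]: "orient p q p = 0" "orient p q q = 0"
  by (simp_all add: orient_def algebra_simps)

lemma orient_affine:
  assumes "u + v = 1"
  shows "orient p q (u *\<^sub>R x + v *\<^sub>R y) = u * orient p q x + v * orient p q y"
proof -
  have u: "u = 1 - v" using assms by simp
  show ?thesis unfolding u by (simp add: orient_def algebra_simps)
qed

lemma vec2_eq_iff: "(x :: point) = y \<longleftrightarrow> x $ 1 = y $ 1 \<and> x $ 2 = y $ 2"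
  by (simp add: vec_eq_iff forall_2)

lemma orient_collinear:
  assumes "orient p q s = 0" and "p \<noteq> q"
  obtains t where "s = p + t *\<^sub>R (q - p)"
proof (cases "q $ 1 = p $ 1")
  case True
  then have "q $ 2 \<noteq> p $ 2" using assms(2) by (simp add: vec2_eq_iff)
  then have "s = p + ((s $ 2 - p $ 2) / (q $ 2 - p $ 2)) *\<^sub>R (q - p)"
    using assms(1) True by (simp add: vec2_eq_iff orient_def)
  then show ?thesis using that by blast
next
  case False
  define t where "t = (s $ 1 - p $ 1) / (q $ 1 - p $ 1)"
  have "s $ 1 - p $ 1 = t * (q $ 1 - p $ 1)" "s $ 2 - p $ 2 = t * (q $ 2 - p $ 2)"
    using assms(1) False by (simp_all add: t_def orient_def nonzero_eq_divide_eq mult.commute)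
  then have "s = p + t *\<^sub>R (q - p)" by (simp add: vec2_eq_iff)
  then show ?thesis using that by blast
qed

text \<open>The half-plane to the left of the directed line from \<open>p\<close> to
  \<open>q\<close> is taken closed, so that an edge sharing an end point with \<open>{p, q}\<close>
  fits into a side.\<close>

definition side :: "point set \<Rightarrow> point \<Rightarrow> point \<Rightarrow> point set" where
  "side P p q = {r \<in> P. 0 \<le> orient p q r}"

lemma hull_edge_edges_on: "hull_edge P h \<Longrightarrow> h \<in> edges_on P"
  by (simp add: hull_edge_def)

section \<open>Crossings and hull edges for points in convex position\<close>

locale convex_point_set =
  fixes P :: "point set"
  assumes finite_P: "finite P" and convex_position: "convex_position P"
begin

text \<open>The hull without the extreme point \<open>p\<close> is still convex and contains the
  triangle \<open>a b c\<close>. The weights are not normalised, so that orientations can serve as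
  weights.\<close>

lemma extreme_not_convex_comb:
  assumes "p \<in> P" and "{a, b, c} \<subseteq> P - {p}" and "0 \<le> x" and "0 \<le> y" and "0 \<le> z" and "0 < x + y + z"
    and "x *\<^sub>R a + y *\<^sub>R b + z *\<^sub>R c = (x + y + z) *\<^sub>R p"
  shows False
proof -
  define s where "s = x + y + z"
  have "p extreme_point_of (convex hull P)"
    using convex_position assms(1) by (simp add: convex_position_def)
  then have "convex (convex hull P - {p})" using extreme_point_of_stillconvex by blast
  then have "convex hull {a, b, c} \<subseteq> convex hull P - {p}"
    using assms(2) by (intro hull_minimal) (auto intro: hull_inc)
  moreover have "(x / s) *\<^sub>R a + (y / s) *\<^sub>R b + (z / s) *\<^sub>R c = p"
  proof -
    have "(1 / s) *\<^sub>R (x *\<^sub>R a + y *\<^sub>R b + z *\<^sub>R c) = (1 / s) *\<^sub>R (s *\<^sub>R p)"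
      using assms(7) by (simp add: s_def)
    then show ?thesis using assms(6) by (simp add: s_def scaleR_add_right)
  qed
  then have "p \<in> convex hull {a, b, c}"
    unfolding convex_hull_3 using assms(3-6)
    by (intro CollectI exI[of _ "x / s"] exI[of _ "y / s"] exI[of _ "z / s"] conjI)
      (auto simp: s_def add_divide_distrib[symmetric])
  ultimately show False by blast
qed

text \<open>Of three points on a line, one would lie between the other two and not be
  extreme.\<close>

lemma orient_eq_0:
  assumes "{p, q, s} \<subseteq> P" and "p \<noteq> q" and "orient p q s = 0"
  shows "s = p \<or> s = q"
proof (rule ccontr)
  assume neq: "\<not> (s = p \<or> s = q)"
  obtain t where s: "s = p + t *\<^sub>R (q - p)" using orient_collinear assms(2,3) by blast
  \<comment> \<open>These identities show \<open>p\<close>, \<open>s\<close> or \<open>q\<close> as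
    the middle point, for \<open>t < 0\<close>, \<open>0 \<le> t \<le> 1\<close> and
    \<open>1 < t\<close>.\<close>
  have "1 *\<^sub>R s + (- t) *\<^sub>R q = (1 + - t) *\<^sub>R p" "(1 - t) *\<^sub>R p + t *\<^sub>R q = s"
    "1 *\<^sub>R s + (t - 1) *\<^sub>R p = t *\<^sub>R q"
    by (simp_all add: s algebra_simps)
  then have False if "t < 0 \<or> 0 \<le> t \<and> t \<le> 1 \<or> 1 < t"
    using extreme_not_convex_comb[of p s q q 1 "- t" 0] extreme_not_convex_comb[of s p q q "1 - t" t 0]
      extreme_not_convex_comb[of q s p p 1 "t - 1" 0] assms neq that by auto
  then show False by linarith
qed

lemma side_Int:
  assumes "p \<in> P" and "q \<in> P" and "p \<noteq> q"
  shows "side P p q \<inter> side P q p = {p, q}"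
proof -
  have "s \<in> {p, q}" if "s \<in> side P p q" "s \<in> side P q p" for s
    using that orient_eq_0[of p q s] assms by (auto simp: side_def orient_swap[of p q])
  then show ?thesis using assms by (auto simp: side_def)
qed

text \<open>Otherwise \<open>e\<close> has its ends strictly on both sides of the line through
  \<open>p\<close> and \<open>q\<close> and meets it at some \<open>z\<close>. Either
  \<open>z\<close> lies on the segment and is a crossing, or one of \<open>p\<close> and
  \<open>q\<close> lies in the triangle of the other and the ends of \<open>e\<close>, against
  convex position.\<close>

lemma noncrossing_side:
  assumes "{p, q} \<in> edges_on P" and "e \<in> edges_on P" and "\<not> crossing e {p, q}"
  shows "e \<subseteq> side P p q \<or> e \<subseteq> side P q p"
proof (rule ccontr)
  assume no: "\<not> ?thesis"
  have pq: "p \<in> P" "q \<in> P" "p \<noteq> q" using assms(1) by (auto simp: edges_on_def doubleton_eq_iff)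
  obtain u0 v0 where e0: "e = {u0, v0}" "u0 \<in> P" "v0 \<in> P" using assms(2) by (auto simp: edges_on_def)
  then have "orient p q u0 > 0 \<and> orient p q v0 < 0 \<or> orient p q v0 > 0 \<and> orient p q u0 < 0"
    using no by (auto simp: side_def orient_swap[of p q])
  then obtain u v where e: "e = {u, v}" "u \<in> P" "v \<in> P" "orient p q u > 0" "orient p q v < 0"
    using e0 by (metis insert_commute)
  define A where "A = orient p q u"
  define B where "B = - orient p q v"
  have AB: "0 < A" "0 < B" using e by (auto simp: A_def B_def)
  \<comment> \<open>These weights cancel the orientations of \<open>u\<close> and \<open>v\<close>,
    so \<open>z\<close> is the point of \<open>e\<close> on the line.\<close>
  define z where "z = (B / (A + B)) *\<^sub>R u + (A / (A + B)) *\<^sub>R v"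
  have sum: "B / (A + B) + A / (A + B) = 1" using AB by (simp add: add_divide_distrib[symmetric] add.commute)
  have "orient p q z = 0"
    unfolding z_def orient_affine[OF sum] using AB by (simp add: A_def[symmetric]) (simp add: B_def)
  then obtain t where t: "z = p + t *\<^sub>R (q - p)" using orient_collinear pq by blast
  have "(A + B) *\<^sub>R z = B *\<^sub>R u + A *\<^sub>R v" using AB by (simp add: z_def scaleR_add_right)
  then have z: "B *\<^sub>R u + A *\<^sub>R v = (A + B) *\<^sub>R (p + t *\<^sub>R (q - p))" using t by simp
  have uv: "u \<noteq> p" "u \<noteq> q" "v \<noteq> p" "v \<noteq> q" using e by auto
  consider "t < 0" | "0 \<le> t" "t \<le> 1" | "1 < t" by linarith
  then show False
  proof cases
    case 1
    define w where "w = (A + B) * - t"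
    have w: "0 < w" unfolding w_def using AB 1 by (intro mult_pos_pos) auto
    have "B *\<^sub>R u + A *\<^sub>R v + w *\<^sub>R q = (B + A + w) *\<^sub>R p"
      unfolding z w_def by (simp add: algebra_simps)
    then show False
      using extreme_not_convex_comb[of p u v q B A w] uv pq e AB w by auto
  next
    case 2
    then have "z \<in> convex hull {p, q}" using t
      by (auto simp: segment_convex_hull[symmetric] in_segment algebra_simps intro!: exI[of _ t])
    moreover have "z \<in> convex hull e"
      unfolding e z_def convex_hull_2 using AB sum
      by (intro CollectI exI[of _ "B / (A + B)"] exI[of _ "A / (A + B)"]) auto
    moreover have "e \<inter> {p, q} = {}" using uv e by auto
    moreover from this have "e \<noteq> {p, q}" by auto
    ultimately show False using assms(3) by (auto simp: crossing_def)
  next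
    case 3
    define w where "w = (A + B) * (t - 1)"
    have w: "0 < w" unfolding w_def using AB 3 by (intro mult_pos_pos) auto
    have "B *\<^sub>R u + A *\<^sub>R v + w *\<^sub>R p = (B + A + w) *\<^sub>R q"
      unfolding z w_def by (simp add: algebra_simps)
    then show False
      using extreme_not_convex_comb[of q u v p B A w] uv pq e AB w by auto
  qed
qed

text \<open>An extreme point of the whole hull is also extreme in the smaller set
  \<open>convex hull e\<close>.\<close>

lemma convex_hull_edge_Int:
  assumes "e \<in> edges_on P" and "x \<in> P" and "x \<in> convex hull e"
  shows "x \<in> e"
proof -
  have "e \<subseteq> P" using assms(1) edges_on_sub by blast
  then have "convex hull e \<subseteq> convex hull P" by (rule hull_mono)
  then have "x extreme_point_of (convex hull e)"
    using assms convex_position by (auto simp: convex_position_def extreme_point_of_def)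
  then show ?thesis using extreme_point_of_convex_hull by blast
qed

text \<open>\<open>orient p q\<close> is affine and nonnegative at both ends of \<open>e\<close>. It
  vanishes at \<open>z\<close> only if \<open>z\<close> is an end of \<open>e\<close> or both ends
  lie on the line.\<close>

lemma convex_hull_side:
  assumes "e \<in> edges_on P" and "e \<subseteq> side P p q" and "z \<in> convex hull e"
    and "{p, q} \<in> edges_on P"
  shows "0 \<le> orient p q z" and "orient p q z = 0 \<Longrightarrow> z \<in> e \<or> e = {p, q}"
proof -
  have pq: "p \<in> P" "q \<in> P" "p \<noteq> q" using assms(4) by (auto simp: edges_on_def doubleton_eq_iff)
  obtain u v where e: "e = {u, v}" "u \<noteq> v" "u \<in> P" "v \<in> P" using assms(1) by (auto simp: edges_on_def)
  then have uv: "0 \<le> orient p q u" "0 \<le> orient p q v" using assms(2) by (auto simp: side_def)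
  obtain x y where xy: "0 \<le> x" "0 \<le> y" "x + y = 1" "z = x *\<^sub>R u + y *\<^sub>R v"
    using assms(3) e by (auto simp: convex_hull_2)
  then have z: "orient p q z = x * orient p q u + y * orient p q v" by (simp add: orient_affine)
  then show "0 \<le> orient p q z" using uv xy by simp
  assume "orient p q z = 0"
  then have "x * orient p q u = 0 \<and> y * orient p q v = 0"
    unfolding z using uv xy by (simp add: add_nonneg_eq_0_iff)
  then consider "x = 0" | "y = 0" | "orient p q u = 0" "orient p q v = 0" by auto
  then show "z \<in> e \<or> e = {p, q}"
  proof cases
    case 3
    then have "u \<in> {p, q}" "v \<in> {p, q}" using orient_eq_0[of p q] e pq by auto
    then show ?thesis using e by auto
  qed (use xy e in auto)
qed

text \<open>A common point lies on the line through \<open>p\<close> and \<open>q\<close>, hence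
  belongs to \<open>P\<close> by \<open>convex_hull_side\<close>, and a point of \<open>P\<close> on
  an edge is an end point of it.\<close>

lemma opposite_sides_noncrossing:
  assumes "e \<in> edges_on P" and "g \<in> edges_on P" and "{p, q} \<in> edges_on P"
    and "e \<subseteq> side P p q" and "g \<subseteq> side P q p"
  shows "\<not> crossing e g"
proof
  assume "crossing e g"
  then obtain z where z: "z \<in> convex hull e" "z \<in> convex hull g" "z \<notin> e \<inter> g" and neq: "e \<noteq> g"
    by (auto simp: crossing_def)
  have qp: "{q, p} \<in> edges_on P" using assms(3) by (simp add: insert_commute)
  have "orient p q z = 0"
    using convex_hull_side(1)[OF assms(1,4) z(1) assms(3)] convex_hull_side(1)[OF assms(2,5) z(2) qp]
    by (simp add: orient_swap[of p q])
  then have "z \<in> e \<or> e = {p, q}" "z \<in> g \<or> g = {p, q}"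
    using convex_hull_side(2)[OF assms(1,4) z(1) assms(3)] convex_hull_side(2)[OF assms(2,5) z(2) qp]
    by (auto simp: orient_swap[of p q])
  then have "z \<in> P" using neq assms(1,2) edges_on_sub by blast
  then show False using convex_hull_edge_Int assms(1,2) z by blast
qed

text \<open>A common point that is no common end point is interior to the segment \<open>e\<close>.
  Since \<open>convex hull h\<close> is a face, it then contains both ends of \<open>e\<close>, so
  \<open>e = h\<close>.\<close>

lemma hull_edge_noncrossing:
  assumes h: "hull_edge P h" and e: "e \<in> edges_on P"
  shows "\<not> crossing h e" and "\<not> crossing e h"
proof -
  have "False" if z: "z \<in> convex hull h" "z \<in> convex hull e" "z \<notin> h \<inter> e" and neq: "h \<noteq> e" for z
  proof -
    have hP: "h \<in> edges_on P" and face: "(convex hull h) face_of (convex hull P)"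
      using h by (auto simp: hull_edge_def edge_of_def)
    obtain u v where uv: "e = {u, v}" "u \<noteq> v" "u \<in> P" "v \<in> P" using e by (auto simp: edges_on_def)
    have "z \<notin> P" using convex_hull_edge_Int[OF hP] convex_hull_edge_Int[OF e] z by blast
    then have "z \<in> open_segment u v"
      using z(2) uv by (auto simp: open_segment_def segment_convex_hull)
    then have "u \<in> convex hull h" "v \<in> convex hull h"
      using face_ofD[OF face, of z u v] z(1) uv hull_inc by metis+
    then have "e \<subseteq> h" using convex_hull_edge_Int[OF hP] uv by auto
    then show False using neq uv hP by (auto simp: edges_on_def)
  qed
  then show "\<not> crossing h e" "\<not> crossing e h" by (auto simp: crossing_def)
qed

text \<open>With no point strictly to the left, the line through \<open>p\<close> and
  \<open>q\<close> supports the hull, and the face on it is the segment.\<close>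

lemma hull_edge_side_empty:
  assumes "{p, q} \<in> edges_on P" and "side P p q = {p, q}"
  shows "hull_edge P {p, q}"
proof -
  have pq: "p \<in> P" "q \<in> P" "p \<noteq> q" using assms(1) by (auto simp: edges_on_def doubleton_eq_iff)
  \<comment> \<open>The normal of the line that points to the left.\<close>
  define a :: point where "a = vector [- (q $ 2 - p $ 2), q $ 1 - p $ 1]"
  have orient: "orient p q r = a \<bullet> r - a \<bullet> p" for r
    by (simp add: orient_def a_def inner_vec_def sum_2 algebra_simps)
  have le: "a \<bullet> x \<le> a \<bullet> p" if "x \<in> convex hull P" for x
  proof -
    have "r \<in> {x. a \<bullet> x \<le> a \<bullet> p}" if "r \<in> P" for r
    proof (cases "r \<in> side P p q")
      case True
      then have "r = p \<or> r = q" using assms(2) by auto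
      then show ?thesis using orient[of q] by auto
    qed (use that orient[of r] in \<open>auto simp: side_def\<close>)
    then have "convex hull P \<subseteq> {x. a \<bullet> x \<le> a \<bullet> p}"
      by (intro hull_minimal) (auto simp: convex_halfspace_le)
    then show ?thesis using that by blast
  qed
  let ?F = "convex hull P \<inter> {x. a \<bullet> x = a \<bullet> p}"
  have face: "?F face_of (convex hull P)"
    by (rule face_of_Int_supporting_hyperplane_le) (use le in auto)
  \<comment> \<open>A face of a polytope is spanned by points of \<open>P\<close>; those on the line
    are only \<open>p\<close> and \<open>q\<close>.\<close>
  obtain S where S: "S \<subseteq> P" "?F = convex hull S"
    using face_of_convex_hull_subset[OF finite_imp_compact[OF finite_P] face] by blast
  have "S \<subseteq> {p, q}"
  proof
    fix r assume "r \<in> S"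
    then have "r \<in> ?F" unfolding S(2) by (rule hull_inc)
    then have "a \<bullet> r = a \<bullet> p" by simp
    moreover have "r \<in> P" using \<open>r \<in> S\<close> S(1) by blast
    ultimately have "r \<in> side P p q" using orient[of r] by (simp add: side_def)
    then show "r \<in> {p, q}" using assms(2) by simp
  qed
  then have sub: "?F \<subseteq> convex hull {p, q}" unfolding S(2) by (rule hull_mono)
  have "a \<bullet> q = a \<bullet> p" using orient[of q] by simp
  then have "{p, q} \<subseteq> ?F" using pq by (auto intro: hull_inc)
  then have "convex hull {p, q} \<subseteq> ?F"
    by (rule hull_minimal) (auto intro: convex_Int convex_hyperplane)
  then have "?F = convex hull {p, q}" using sub by (rule antisym[rotated])
  then have "(convex hull {p, q}) face_of (convex hull P)" using face by simp
  then show ?thesis using assms(1) pq(3) by (simp add: hull_edge_def edge_of_def aff_dim_convex_hull aff_dim_2)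
qed

text \<open>If \<open>s\<close> were strictly to the right of \<open>p q\<close>, then
  \<open>p\<close> in the first case and \<open>q\<close> in the second would lie in the triangle of
  the other three points.\<close>

lemma orient_triangle:
  assumes "{p, q, r, s} \<subseteq> P" and "0 < orient p q r" and "0 \<le> orient p r s \<or> 0 \<le> orient r q s"
  shows "0 \<le> orient p q s"
proof (rule ccontr)
  assume "\<not> ?thesis"
  then have neg: "0 < - orient p q s" by simp
  let ?D = "orient p q r" and ?S = "orient p q s"
  have neq: "s \<noteq> p" "s \<noteq> q" "r \<noteq> p" "r \<noteq> q" "p \<noteq> q" using neg assms(2) by (auto simp: orient_def)
  \<comment> \<open>Barycentric coordinates, given by orientations up to a common factor.\<close>
  have "?D *\<^sub>R s + (- ?S) *\<^sub>R r + orient p r s *\<^sub>R q = (?D + - ?S + orient p r s) *\<^sub>R p"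
    by (simp add: vec2_eq_iff orient_def algebra_simps)
  moreover have "?D *\<^sub>R s + (- ?S) *\<^sub>R r + orient r q s *\<^sub>R p = (?D + - ?S + orient r q s) *\<^sub>R q"
    by (simp add: vec2_eq_iff orient_def algebra_simps)
  ultimately show False
    using extreme_not_convex_comb[of p s r q ?D "- ?S" "orient p r s"]
      extreme_not_convex_comb[of q s r p ?D "- ?S" "orient r q s"] assms neg neq by auto
qed

text \<open>The walk is the part of the hull boundary to the left of \<open>p q\<close>. A point
  \<open>r\<close> strictly on the left splits it into the parts for \<open>p r\<close> and
  \<open>r q\<close>, which have fewer points strictly on their left because \<open>r\<close> is no
  longer one of them.\<close>

lemma hull_edges_linked:
  assumes "{p, q} \<in> edges_on P"
  shows "linked {h. hull_edge P h \<and> h \<subseteq> side P p q} p q"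
  using assms
proof (induction "card {s \<in> P. 0 < orient p q s}" arbitrary: p q rule: less_induct)
  case less
  have pq: "p \<in> P" "q \<in> P" "p \<noteq> q" using less(2) by (auto simp: edges_on_def doubleton_eq_iff)
  show ?case
  proof (cases "\<exists>r\<in>P. 0 < orient p q r")
    case False
    then have "side P p q = {p, q}"
      using pq orient_eq_0[of p q] by (force simp: side_def)
    then show ?thesis using hull_edge_side_empty[OF less(2)] by (auto intro: linked_edge)
  next
    case True
    then obtain r where r: "r \<in> P" "0 < orient p q r" by blast
    then have neq: "r \<noteq> p" "r \<noteq> q" by auto
    have ord: "orient p r q < 0" "orient r q p < 0"
      using r(2) orient_swap[of r p q] orient_swap[of q r p] orient_rotate[of p q r] orient_rotate[of q r p]
      by (auto simp: orient_def algebra_simps)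
    have tri: "0 \<le> orient p q s" if "s \<in> P" "0 \<le> orient p r s \<or> 0 \<le> orient r q s" for s
      using orient_triangle[of p q r s] that pq r by auto
    have tri': "0 < orient p q s" if s: "s \<in> P" "0 < orient p r s \<or> 0 < orient r q s" for s
    proof -
      have "s \<noteq> p" "s \<noteq> q" using s(2) ord by auto
      then show ?thesis using tri[of s] s orient_eq_0[of p q s] pq by force
    qed
    have fin: "finite {s \<in> P. 0 < orient p q s}" using finite_P by simp
    have "r \<in> {s \<in> P. 0 < orient p q s}" using r by simp
    moreover have "r \<notin> {s \<in> P. 0 < orient p r s}" "r \<notin> {s \<in> P. 0 < orient r q s}" by auto
    ultimately have "{s \<in> P. 0 < orient p r s} \<subset> {s \<in> P. 0 < orient p q s}"
      "{s \<in> P. 0 < orient r q s} \<subset> {s \<in> P. 0 < orient p q s}"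
      using tri' by blast+
    then have card: "card {s \<in> P. 0 < orient p r s} < card {s \<in> P. 0 < orient p q s}"
      "card {s \<in> P. 0 < orient r q s} < card {s \<in> P. 0 < orient p q s}"
      by (auto intro: psubset_card_mono[OF fin])
    have "{p, r} \<in> edges_on P" "{r, q} \<in> edges_on P" using pq r neq by (auto simp: edges_on_def)
    then have "linked {h. hull_edge P h \<and> h \<subseteq> side P p r} p r" "linked {h. hull_edge P h \<and> h \<subseteq> side P r q} r q"
      using less(1)[OF card(1)] less(1)[OF card(2)] by simp_all
    moreover have "side P p r \<subseteq> side P p q" "side P r q \<subseteq> side P p q"
      using tri by (auto simp: side_def)
    ultimately have "linked {h. hull_edge P h \<and> h \<subseteq> side P p q} p r" "linked {h. hull_edge P h \<and> h \<subseteq> side P p q} r q"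
      by (auto intro: linked_mono[where E = "{h. hull_edge P h \<and> h \<subseteq> side P p r}"]
          linked_mono[where E = "{h. hull_edge P h \<and> h \<subseteq> side P r q}"])
    then show ?thesis by (rule linked_trans)
  qed
qed

end

section \<open>Plane spanning trees and flips\<close>

lemma crossing_sym: "crossing e f \<longleftrightarrow> crossing f e"
  by (auto simp: crossing_def)

text \<open>If \<open>F\<close> linked the ends of every edge of \<open>E\<close>, it could follow
  the walk. Used to find an edge that joins two components of \<open>F\<close>.\<close>

lemma linked_witness:
  assumes "linked E u v" and "\<not> linked F u v"
  obtains c d where "{c, d} \<in> E" and "\<not> linked F c d"
proof -
  have "linked F u v" if "\<forall>c d. {c, d} \<in> E \<longrightarrow> linked F c d"
    using assms(1)
  proof (induction rule: linked_induct)
    case (step x y)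
    then show ?case using that linked_trans[of F u x y] by simp
  qed simp
  then show ?thesis using assms(2) that by blast
qed

section \<open>Exchanges in plane spanning trees\<close>

context convex_point_set
begin

abbreviation tree :: "edge set \<Rightarrow> bool" where
  "tree T \<equiv> plane_spanning_tree P T"

abbreviation outer :: "edge \<Rightarrow> bool" where
  "outer h \<equiv> hull_edge P h"

lemma tree_spanning: "tree T \<Longrightarrow> spanning P T"
  using plane_spanning_tree_iff[OF finite_P] by blast

lemma tree_edges_on: "tree T \<Longrightarrow> e \<in> T \<Longrightarrow> e \<in> edges_on P"
  using tree_spanning by (auto simp: spanning_def)

lemma tree_noncrossing: "tree T \<Longrightarrow> e \<in> T \<Longrightarrow> f \<in> T \<Longrightarrow> \<not> crossing e f"
  using plane_spanning_tree_iff[OF finite_P] by blast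

lemma tree_exchange:
  assumes "tree T" and "spanning P (insert b (T - {a}))"
    and "\<And>g. g \<in> T \<Longrightarrow> g \<noteq> a \<Longrightarrow> \<not> crossing b g"
  shows "tree (insert b (T - {a}))"
proof -
  have "\<not> crossing b b" by (simp add: crossing_def)
  then show ?thesis
    using assms crossing_sym tree_noncrossing[OF assms(1)]
    by (auto simp: plane_spanning_tree_iff[OF finite_P])
qed

lemma tree_exchange_hull:
  assumes "tree T" and "spanning P (insert x (T - {a}))" and "outer x"
  shows "tree (insert x (T - {a}))"
  using assms hull_edge_noncrossing tree_edges_on by (intro tree_exchange) auto

lemma tree_side:
  assumes "tree T" and "{p, q} \<in> T" and "e \<in> T"
  shows "e \<subseteq> side P p q \<or> e \<subseteq> side P q p"
  using noncrossing_side tree_edges_on tree_noncrossing assms by blast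

lemma edge_both_sides:
  assumes "e \<in> edges_on P" and "{p, q} \<in> edges_on P" and "e \<subseteq> side P p q" and "e \<subseteq> side P q p"
  shows "e = {p, q}"
proof -
  have pq: "p \<in> P" "q \<in> P" "p \<noteq> q" using assms(2) by (auto simp: edges_on_def doubleton_eq_iff)
  then have "e \<subseteq> {p, q}" using side_Int[OF pq] assms(3,4) by blast
  then show ?thesis using assms(1) by (auto simp: edges_on_def)
qed

text \<open>Since the tree contains \<open>{p, q}\<close>, its edges on the side of \<open>e\<close>
  already link the ends of \<open>e\<close>, and \<open>a\<close> is not among them. So
  \<open>e\<close> cannot reconnect \<open>T - {a}\<close>.\<close>

lemma opposite_exchange:
  assumes "tree T" and "{p, q} \<in> T" and "a \<in> T" and "a \<noteq> {p, q}" and "a \<subseteq> side P p q"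
    and "e \<in> edges_on P" and "e \<notin> T" and "e \<subseteq> side P q p"
  shows "\<not> spanning P (insert e (T - {a}))"
proof -
  have pq: "p \<in> P" "q \<in> P" "p \<noteq> q"
    using tree_edges_on[OF assms(1,2)] by (auto simp: edges_on_def doubleton_eq_iff)
  obtain c d where e: "e = {c, d}" "c \<in> P" "d \<in> P" using assms(6) by (auto simp: edges_on_def)
  have "linked T c d"
    using tree_spanning[OF assms(1)] e by (auto simp: spanning_def connected_graph_linked)
  then have "linked {g \<in> T. g \<subseteq> side P q p} c d"
    using linked_restrict[of "side P q p" "side P p q" p q T c d] side_Int[OF pq]
      tree_side[OF assms(1,2)] assms(2,8) e by (auto simp: Int_commute)
  moreover have "\<not> a \<subseteq> side P q p"
    using edge_both_sides tree_edges_on assms(1-5) by blast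
  then have "{g \<in> T. g \<subseteq> side P q p} \<subseteq> T - {a}" by blast
  ultimately have "linked (T - {a}) c d" by (rule linked_mono)
  then show ?thesis
    using spanning_exchange_iff[OF finite_P tree_spanning[OF assms(1)] assms(3)] assms(6,7) e by auto
qed

text \<open>The hull edges on this side link \<open>p\<close> and \<open>q\<close>, which lie in
  different components of \<open>T - {{p, q}}\<close>, so one of these edges joins the two
  components.\<close>

lemma hull_gap:
  assumes "tree T" and "{p, q} \<in> T" and "\<not> outer {p, q}"
  obtains x where "outer x" and "x \<subseteq> side P p q" and "x \<notin> T" and "spanning P (insert x (T - {{p, q}}))"
proof -
  let ?f = "{p, q}"
  have "\<not> linked (T - {?f}) p q"
    using spanning_remove[OF finite_P tree_spanning[OF assms(1)] assms(2)] .
  with hull_edges_linked[OF tree_edges_on[OF assms(1,2)]]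
  obtain c d where cd: "{c, d} \<in> {h. outer h \<and> h \<subseteq> side P p q}" "\<not> linked (T - {?f}) c d"
    by (rule linked_witness)
  have "{c, d} \<noteq> ?f" using cd(1) assms(3) by (metis (mono_tags) mem_Collect_eq)
  then have "{c, d} \<notin> T" using cd(2) linked_edge[of c d "T - {?f}"] by blast
  moreover from this have "spanning P (insert {c, d} (T - {?f}))"
    using spanning_exchange_iff[OF finite_P tree_spanning[OF assms(1)] assms(2)]
      cd hull_edge_edges_on by auto
  ultimately show ?thesis using that[of "{c, d}"] cd(1) by blast
qed

end

section \<open>Flip sequences with kept edges and the repair of hull edge flips\<close>

locale flip_problem = convex_point_set +
  fixes cmp :: bool and TF :: "edge set"
  assumes tree_TF: "plane_spanning_tree P TF"
begin

text \<open>\<open>cmp\<close> selects the compatible case, so that both claims share one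
  proof.\<close>

definition step :: "edge \<Rightarrow> edge \<Rightarrow> edge set \<Rightarrow> edge set \<Rightarrow> bool" where
  "step a b T T' \<longleftrightarrow> flip P a b T T' \<and> (cmp \<longrightarrow> \<not> crossing a b)"

lemma stepI:
  assumes "tree T" and "tree T'" and "a \<in> T" and "b \<notin> T" and "T' = insert b (T - {a})"
    and "cmp \<Longrightarrow> \<not> crossing a b"
  shows "step a b T T'"
  using assms by (simp add: step_def flip_def)

lemma stepD:
  assumes "step a b T T'"
  shows "tree T" and "tree T'" and "a \<in> T" and "b \<notin> T" and "T' = insert b (T - {a})"
    and "cmp \<Longrightarrow> \<not> crossing a b" and "a \<noteq> b" and "a \<notin> T'" and "b \<in> T'"
    and "spanning P (insert b (T - {a}))"
  using assms tree_spanning[of T'] unfolding step_def flip_def by blast+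

lemma step_back: "step a b T T' \<Longrightarrow> insert a (T' - {b}) = T"
  using stepD by blast

text \<open>The edges in \<open>K\<close> must not be removed any more; \<open>g a b\<close> says that \<open>b\<close> joins them after the flip
  \<open>a \<rightarrow> b\<close>. With \<open>g = guarded\<close>, this excludes exactly the flips to be repaired.\<close>

inductive route :: "(edge \<Rightarrow> edge \<Rightarrow> bool) \<Rightarrow> edge set \<Rightarrow> edge set \<Rightarrow> nat \<Rightarrow> bool" for g where
  route_0: "K \<subseteq> TF \<Longrightarrow> route g K TF 0"
| route_Suc: "K \<subseteq> T \<Longrightarrow> step a b T T' \<Longrightarrow> route g (if g a b then insert b K else K) T' n \<Longrightarrow>
    route g K T (Suc n)"

text \<open>With this guard \<open>K\<close> never grows: its edges just belong to every
  tree.\<close>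

abbreviation path :: "edge set \<Rightarrow> edge set \<Rightarrow> nat \<Rightarrow> bool" where
  "path \<equiv> route (\<lambda>_ _. False)"

text \<open>The first part makes the flip of a hull edge the last one in its trace. The second part
  admits, in the compatible case, only hull edges as intermediate positions.\<close>

definition guarded :: "edge \<Rightarrow> edge \<Rightarrow> bool" where
  "guarded a b \<longleftrightarrow> outer a \<or> cmp \<and> \<not> outer b"

abbreviation tame :: "edge set \<Rightarrow> edge set \<Rightarrow> nat \<Rightarrow> bool" where
  "tame \<equiv> route guarded"

text \<open>The other outcome of every repair, refuted at the end by minimality.\<close>

definition shorter :: "edge set \<Rightarrow> nat \<Rightarrow> bool" where
  "shorter T n \<longleftrightarrow> (\<exists>m<n. path {} T m)"

lemma route_sub: "route g K T n \<Longrightarrow> K \<subseteq> T"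
  by (induction rule: route.induct) auto

lemma route_removed: "step a b T T' \<Longrightarrow> route g K T' n \<Longrightarrow> a \<notin> K"
  using route_sub stepD(8) by blast

lemma route_mono:
  assumes "route g K T n" and "K' \<subseteq> K" and "\<And>a b. g' a b \<Longrightarrow> g a b"
  shows "route g' K' T n"
  using assms(1,2)
proof (induction arbitrary: K' rule: route.induct)
  case (route_0 K)
  then show ?case by (intro route.route_0) auto
next
  case (route_Suc K T a b T' n)
  have "(if g' a b then insert b K' else K') \<subseteq> (if g a b then insert b K else K)"
    using route_Suc.prems assms(3) by auto
  then show ?case using route_Suc route.route_Suc[of K' T a b T' g' n] by blast
qed

lemma path_Suc: "K \<subseteq> T \<Longrightarrow> step a b T T' \<Longrightarrow> path K T' n \<Longrightarrow> path K T (Suc n)"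
  by (rule route_Suc) auto

lemma route_path: "route g K T n \<Longrightarrow> K' \<subseteq> K \<Longrightarrow> path K' T n"
  by (erule route_mono) auto

lemma shorter_path: "path K T m \<Longrightarrow> m < n \<Longrightarrow> shorter T n"
  using route_path[of _ K T m "{}"] by (auto simp: shorter_def)

lemma shorter_step: "step a b T T' \<Longrightarrow> shorter T' n \<Longrightarrow> shorter T (Suc n)"
  using path_Suc[of "{}" T a b T'] by (force simp: shorter_def)

lemma tame_or_shorter_step:
  assumes "K \<subseteq> T" and "step a b T T'"
    and "tame (if guarded a b then insert b K else K) T' n \<or> shorter T' n"
  shows "tame K T (Suc n) \<or> shorter T (Suc n)"
  using assms(3) route_Suc[where g = guarded, OF assms(1,2)] shorter_step[OF assms(2)] by blast

lemma hull_noncrossing_step: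
  assumes "tree T" and "b \<in> T" and "outer x"
  shows "\<not> crossing x b"
  using hull_edge_noncrossing tree_edges_on assms by blast

text \<open>Carries out the repair of a flip \<open>x -> f\<close>: the tree with \<open>x\<close>
  in place of \<open>f\<close> follows the given sequence while this replacement remains a tree. In
  the compatible case \<open>f\<close> is a hull edge, so that inserting it later in place of an
  edge \<open>a\<close> that is not a hull edge is no guarded flip.\<close>

lemma tame_hull_flip:
  assumes "tame K T n"
    and IH: "\<And>m K U. m \<le> n \<Longrightarrow> path K U m \<Longrightarrow> tame K U m \<or> shorter U m"
    and "outer x" and "x \<notin> T" and "f \<in> T" and "f \<notin> K" and "cmp \<longrightarrow> outer f"
    and "spanning P (insert x (T - {f}))"
  shows "tame K (insert x (T - {f})) (Suc n) \<or> shorter (insert x (T - {f})) (Suc n)"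
  using assms
proof (induction arbitrary: x rule: route.induct)
  case (route_0 K)
  let ?S = "insert x (TF - {f})"
  have S: "tree ?S" using tree_exchange_hull tree_TF route_0.prems(2-7) by blast
  \<comment> \<open>At the end \<open>x\<close> is flipped to \<open>f\<close>; this is the extra
    flip.\<close>
  have "step x f ?S TF"
    using S tree_TF hull_noncrossing_step route_0.hyps route_0.prems(2-7) by (intro stepI) auto
  moreover have "tame (if guarded x f then insert f K else K) TF 0"
    using route_0.hyps route_0.prems(2-7) by (intro route.route_0) auto
  ultimately show ?case using route_0.hyps route_0.prems(2-7) by (intro disjI1 route_Suc) auto
next
  case (route_Suc K T a b T2 n)
  note st = stepD[OF route_Suc.hyps(2)]
  let ?S = "insert x (T - {f})"
  let ?K2 = "if guarded a b then insert b K else K"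
  have S: "tree ?S" using tree_exchange_hull st(1) route_Suc.prems(2-7) by blast
  have pathK: "path K T2 n" by (rule route_path[OF route_Suc.hyps(3)]) auto
  have aK: "a \<notin> K" using route_removed[OF route_Suc.hyps(2)] pathK by blast
  have KS: "K \<subseteq> ?S" using route_Suc.hyps(1) route_Suc.prems(2-7) by auto
  have IH': "\<And>m K U. m \<le> n \<Longrightarrow> path K U m \<Longrightarrow> tame K U m \<or> shorter U m"
    using route_Suc.prems(1) by simp
  \<comment> \<open>The question is whether \<open>x\<close> can still replace \<open>f\<close>
    after the flip \<open>a -> b\<close>. The first two cases save a flip, as \<open>x -> f\<close>
    merges with \<open>f -> b\<close> or with \<open>a -> x\<close>.\<close>
  consider "a = f" | "a \<noteq> f" "b = x" | "a \<noteq> f" "b \<noteq> x" "spanning P (insert x (T2 - {f}))"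
    | "a \<noteq> f" "b \<noteq> x" "\<not> spanning P (insert x (T2 - {f}))" by blast
  then show ?case
  proof cases
    case 1
    show ?thesis
    proof (cases "b = x")
      case True
      then have "T2 = ?S" using 1 st by auto
      then show ?thesis using shorter_path[OF pathK] by auto
    next
      case False
      then have "step x b ?S T2"
        using 1 S st hull_noncrossing_step[OF st(2,9)] route_Suc.prems(2-7) by (intro stepI) auto
      then show ?thesis using shorter_path[OF path_Suc[OF KS _ pathK]] by auto
    qed
  next
    case 2
    have "step a f ?S T2"
      using 2 S st tree_noncrossing[OF st(1)] route_Suc.prems(2-7) by (intro stepI) auto
    then show ?thesis using shorter_path[OF path_Suc[OF KS _ pathK]] by auto
  next
    case 3
    let ?S2 = "insert x (T2 - {f})"
    have S2: "tree ?S2" using tree_exchange_hull st(2) route_Suc.prems 3 by blast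
    have "step a b ?S ?S2"
      using 3 S S2 st route_Suc.prems(2-7) by (intro stepI) auto
    moreover have "tame ?K2 ?S2 (Suc n) \<or> shorter ?S2 (Suc n)"
      by (rule route_Suc.IH, erule (1) IH') (use 3 st route_Suc.prems(2-7) in auto)
    ultimately show ?thesis by (rule tame_or_shorter_step[OF KS])
  next
    case 4
    have eq: "insert x (T2 - {f}) = insert b (insert x (T - {f}) - {a})"
      "insert x (T2 - {f}) = insert x (insert b (T - {a}) - {f})"
      using 4 st route_Suc.prems(2-7) by auto
    \<comment> \<open>Otherwise \<open>spanning_double_exchange\<close>, with the exchanges in
      either order, would make \<open>x\<close> a valid replacement after the flip.\<close>
    have sp: "spanning P (insert x (T - {a}))" "spanning P (insert b (T - {f}))"
      using spanning_double_exchange[OF finite_P tree_spanning[OF st(1)], of a f x b]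
        spanning_double_exchange[OF finite_P tree_spanning[OF st(1)], of f a b x]
        4 eq st route_Suc.prems(2-7) by auto
    show ?thesis
    proof (cases "outer a")
      case True
      \<comment> \<open>\<open>x\<close> is flipped instead of \<open>a\<close>, and
        \<open>a\<close> takes over the role of \<open>x\<close>. Both are hull edges, so
        \<open>b\<close> is guarded either way.\<close>
      let ?S2 = "insert a (T2 - {f})"
      have S2_eq: "?S2 = insert b (T - {f})" using 4 st route_Suc.prems(2-7) by auto
      then have S2: "tree ?S2"
        using tree_exchange_hull[OF st(2) _ True, of f] sp by simp
      have "step x b ?S ?S2"
        using 4 S S2 S2_eq st hull_noncrossing_step[OF st(2,9)] route_Suc.prems(2-7) by (intro stepI) auto
      moreover have "tame ?K2 ?S2 (Suc n) \<or> shorter ?S2 (Suc n)"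
        by (rule route_Suc.IH, erule (1) IH') (use True 4 S2_eq sp st route_Suc.prems(2-7) in auto)
      moreover have "?K2 = (if guarded x b then insert b K else K)"
        using True route_Suc.prems(2) by (simp add: guarded_def)
      ultimately show ?thesis using tame_or_shorter_step[OF KS, of x b ?S2] by simp
    next
      case False
      \<comment> \<open>Here \<open>f\<close> enters by \<open>a -> f\<close>, and
        \<open>x -> b\<close> leads back to the given sequence. The rest from \<open>?U\<close> is
        only known to be a path; the assumption on paths of bounded length applies to it.\<close>
      let ?U = "insert x (T - {a})"
      have U: "tree ?U" using tree_exchange_hull st(1) sp route_Suc.prems(2-7) by blast
      have "step a f ?S ?U"
        using 4 S U st tree_noncrossing[OF st(1)] route_Suc.prems(2-7) by (intro stepI) auto
      moreover have "\<not> guarded a f" using False route_Suc.prems(2-7) by (simp add: guarded_def)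
      moreover have "step x b ?U T2"
        using 4 U st hull_noncrossing_step[OF st(2,9)] route_Suc.prems(2-7) by (intro stepI) auto
      then have "path K ?U (Suc n)"
        by (rule path_Suc[rotated, OF _ pathK]) (use aK route_Suc.hyps(1) in auto)
      then have "tame K ?U (Suc n) \<or> shorter ?U (Suc n)" using route_Suc.prems(1) by blast
      ultimately show ?thesis using tame_or_shorter_step[OF KS, of a f ?U] by simp
    qed
  qed
qed

end

section \<open>Commuting flips\<close>

context flip_problem
begin

text \<open>By \<open>opposite_exchange\<close>, an edge on the other side could not reconnect the
  tree.\<close>

lemma step_side:
  assumes "step a b T T'" and "{p, q} \<in> T" and "a \<noteq> {p, q}" and "a \<subseteq> side P p q"
  shows "b \<subseteq> side P p q"
proof -
  note st = stepD[OF assms(1)]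
  have pq: "{p, q} \<in> T'" using st(5) assms(2,3) by simp
  have "\<not> b \<subseteq> side P q p"
    using opposite_exchange[OF st(1) assms(2) st(3) assms(3,4) tree_edges_on[OF st(2,9)] st(4)] st(10)
    by blast
  then show ?thesis using tree_side[OF st(2) pq st(9)] by blast
qed

text \<open>As long as \<open>{p, q}\<close> is present, the flips on its two sides commute, so the first flip on
  \<open>side P p q\<close> can be moved to the front.\<close>

lemma side_first_or_stand_in:
  assumes "tame K T n" and "{p, q} \<in> T" and "{p, q} \<notin> K" and "\<not> outer {p, q}"
  shows "(\<exists>a b T' m. n = Suc m \<and> step a b T T' \<and> a \<noteq> {p, q} \<and> a \<subseteq> side P p q \<and>
        path (if guarded a b then insert b K else K) T' m)
    \<or> (\<exists>x m. m \<le> n \<and> outer x \<and> x \<subseteq> side P p q \<and> x \<notin> T \<and>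
        spanning P (insert x (T - {{p, q}})) \<and> path K (insert x (T - {{p, q}})) m)
    \<or> path (insert {p, q} K) T n" (is "?First K T n \<or> ?Stand_in K T n \<or> ?Keep K T n")
  using assms
proof (induction rule: route.induct)
  case (route_0 K)
  then have "?Keep K TF 0" by (intro route.route_0) auto
  then show ?case by blast
next
  case (route_Suc K T a b T2 n)
  note st = stepD[OF route_Suc.hyps(2)]
  note prems = route_Suc.prems
  let ?f = "{p, q}"
  let ?K2 = "if guarded a b then insert b K else K"
  have path2: "path ?K2 T2 n" "path K T2 n" by (rule route_path[OF route_Suc.hyps(3)]; auto)+
  have fP: "?f \<in> edges_on P" using tree_edges_on[OF st(1) prems(1)] .
  consider "a = ?f" | "a \<noteq> ?f" "a \<subseteq> side P p q" | "a \<noteq> ?f" "a \<subseteq> side P q p"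
    using tree_side[OF st(1) prems(1) st(3)] by blast
  then show ?case
  proof cases
    case 1
    \<comment> \<open>\<open>{p, q}\<close> is removed here, so a hull edge on this side can replace
      it at once and be flipped in its place.\<close>
    obtain x where x: "outer x" "x \<subseteq> side P p q" "x \<notin> T" "spanning P (insert x (T - {?f}))"
      using hull_gap[OF st(1) prems(1,3)] .
    let ?S = "insert x (T - {?f})"
    have S: "tree ?S" using tree_exchange_hull[OF st(1) x(4,1)] .
    have KS: "K \<subseteq> ?S" using route_Suc.hyps(1) prems(2) by blast
    have "\<exists>m\<le>Suc n. path K ?S m"
    proof (cases "b = x")
      case True
      then show ?thesis using path2(2) st(5) 1 by (intro exI[of _ n]) simp
    next
      case False
      have "step x b ?S T2"
        using False 1 S st hull_noncrossing_step[OF st(2,9) x(1)] x by (intro stepI) auto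
      then show ?thesis using path_Suc[OF KS _ path2(2)] by blast
    qed
    then have "?Stand_in K T (Suc n)" using x by blast
    then show ?thesis by blast
  next
    case 2
    then have "?First K T (Suc n)" using route_Suc.hyps(2) path2(1) by blast
    then show ?thesis by blast
  next
    case 3
    \<comment> \<open>A flip on the other side: whatever is found after it is moved in front of
      it.\<close>
    have qpT: "{q, p} \<in> T" using prems(1) by (simp add: insert_commute)
    have f2: "?f \<in> T2" using st(5) 3 prems(1) by simp
    have b_side: "b \<subseteq> side P q p"
      using step_side[OF route_Suc.hyps(2) qpT _ 3(2)] 3(1) by (simp add: insert_commute)
    have bf: "b \<noteq> ?f" using st(4) prems(1) by blast
    then have "?f \<notin> ?K2" using prems(2) by auto
    then have "?First ?K2 T2 n \<or> ?Stand_in ?K2 T2 n \<or> ?Keep ?K2 T2 n"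
      using route_Suc.IH f2 prems(3) by blast
    then consider "?First ?K2 T2 n" | "?Stand_in ?K2 T2 n" | "?Keep ?K2 T2 n" by blast
    then show ?thesis
    proof cases
      case first: 1
      then obtain c d T3 m where n: "n = Suc m" and cd: "step c d T2 T3" "c \<noteq> ?f" "c \<subseteq> side P p q"
        and p3: "path (if guarded c d then insert d ?K2 else ?K2) T3 m" by blast
      note st' = stepD[OF cd(1)]
      have d_side: "d \<subseteq> side P p q" using step_side[OF cd(1) f2 cd(2,3)] .
      have ne: "e \<noteq> g" if "e \<subseteq> side P p q" "g \<subseteq> side P q p" "g \<in> edges_on P" "e \<noteq> ?f" for e g
        using edge_both_sides[OF that(3) fP] that by blast
      have aP: "a \<in> edges_on P" and bP: "b \<in> edges_on P" and dP: "d \<in> edges_on P"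
        using tree_edges_on st(1-3,9) st'(2,9) by blast+
      have df: "d \<noteq> ?f" using st'(4) f2 by blast
      have cb: "c \<noteq> b" and da: "d \<noteq> a" and db: "d \<noteq> b" and ca: "c \<noteq> a"
        using ne[OF cd(3) b_side bP cd(2)] ne[OF d_side 3(2) aP df] ne[OF d_side b_side bP df]
          ne[OF cd(3) 3(2) aP cd(2)] by auto
      have cT: "c \<in> T" using st'(3) st(5) cb by simp
      have dT: "d \<notin> T" using st'(4) st(5) da by simp
      let ?T4 = "insert d (T - {c})"
      have undone: "insert a (T2 - {b}) = T" by (rule step_back[OF route_Suc.hyps(2)])
      have "\<not> spanning P (insert a (T2 - {c}))"
        using opposite_exchange[OF st(2) f2 st'(3) cd(2,3) aP st(8) 3(2)] .
      then have "spanning P (insert d (insert a (T2 - {b}) - {c}))"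
        using spanning_double_exchange[OF finite_P tree_spanning[OF st(2)] st'(3) st(9) cb st(8) st'(4)]
          da st'(10) tree_spanning[OF st(1)] undone by auto
      then have sp4: "spanning P ?T4" unfolding undone .
      have T4: "tree ?T4"
      proof (rule tree_exchange[OF st(1) sp4])
        fix g assume g: "g \<in> T" "g \<noteq> c"
        show "\<not> crossing d g"
        proof (cases "g = a")
          case True
          then show ?thesis using opposite_sides_noncrossing[OF dP aP fP d_side 3(2)] by simp
        next
          case False
          then have "g \<in> T3" using g st(5) st'(5) by simp
          then show ?thesis using tree_noncrossing[OF st'(2,9)] by blast
        qed
      qed
      have step4: "step c d T ?T4" using st(1) T4 cT dT st'(6) by (intro stepI) auto
      have "T3 = insert b (?T4 - {a})" using st(5) st'(5) cb da db ca by auto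
      then have step3: "step a b ?T4 T3"
        using T4 st'(2) st(3,4,6) ca db by (intro stepI) auto
      let ?K4 = "if guarded c d then insert d K else K"
      have p3': "path ?K4 T3 m" by (rule route_path[OF p3]) auto
      have "c \<notin> K" using route_removed[OF cd(1) p3] by (auto split: if_splits)
      then have "?K4 \<subseteq> ?T4" using route_Suc.hyps(1) by auto
      then have "path ?K4 ?T4 (Suc m)" by (rule path_Suc[OF _ step3 p3'])
      then have "?First K T (Suc n)" using n step4 cd(2,3)
        by (intro exI[of _ c] exI[of _ d] exI[of _ ?T4] exI[of _ "Suc m"]) simp
      then show ?thesis by blast
    next
      case stand_in: 2
      then obtain x m where x: "m \<le> n" "outer x" "x \<subseteq> side P p q" "x \<notin> T2"
        "spanning P (insert x (T2 - {?f}))" "path ?K2 (insert x (T2 - {?f})) m" by blast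
      have xP: "x \<in> edges_on P" using x(2) hull_edge_edges_on by blast
      have "x \<noteq> ?f" using x(2) prems(3) by blast
      then have xa: "x \<noteq> a" using edge_both_sides[OF xP fP x(3)] 3(2) by blast
      then have xT: "x \<notin> T" using x(4) st(5) by simp
      have undone: "insert a (T2 - {b}) = T" by (rule step_back[OF route_Suc.hyps(2)])
      have qp2: "{q, p} \<in> T2" using f2 by (simp add: insert_commute)
      have "\<not> spanning P (insert x (T2 - {b}))"
        using opposite_exchange[OF st(2) qp2 st(9) _ b_side xP x(4,3)] bf by (simp add: insert_commute)
      then have "spanning P (insert a (insert x (T2 - {?f}) - {b}))"
        using spanning_double_exchange[OF finite_P tree_spanning[OF st(2)] st(9) f2 bf x(4) st(8) xa x(5)]
          tree_spanning[OF st(1)] undone by auto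
      moreover have "x \<noteq> b" using x(4) st(9) by blast
      then have "insert a (insert x (T2 - {?f}) - {b}) = insert x (T - {?f})"
        using 3(1) undone by auto
      ultimately have sp: "spanning P (insert x (T - {?f}))" by simp
      let ?S = "insert x (T - {?f})" and ?S2 = "insert x (T2 - {?f})"
      have "tree ?S" "tree ?S2"
        using tree_exchange_hull[OF st(1) sp x(2)] tree_exchange_hull[OF st(2) x(5,2)] .
      then have stepS: "step a b ?S ?S2"
        using st(3,4,5,6) xa \<open>x \<noteq> b\<close> 3(1) bf by (intro stepI) auto
      have "K \<subseteq> ?S" using route_Suc.hyps(1) prems(2) by blast
      moreover have "path K ?S2 m" by (rule route_path[OF x(6)]) auto
      ultimately have "path K ?S (Suc m)" by (rule path_Suc[OF _ stepS])
      then have "?Stand_in K T (Suc n)" using x(1-3) xT sp by (intro exI[of _ x] exI[of _ "Suc m"]) simp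
      then show ?thesis by blast
    next
      case keep: 3
      then have "path (insert ?f K) T2 n" by (rule route_path) auto
      then have "?Keep K T (Suc n)"
        by (rule path_Suc[rotated, OF route_Suc.hyps(2)]) (use route_Suc.hyps(1) prems(1) in simp)
      then show ?thesis by blast
    qed
  qed
qed

lemma path_tame:
  assumes "path K T n"
  shows "tame K T n \<or> shorter T n"
  using assms
proof (induction n arbitrary: K T rule: less_induct)
  case (less n)
  show ?case
  proof (cases n)
    case 0
    with less.prems have "T = TF" "K \<subseteq> TF" by (auto elim: route.cases)
    then show ?thesis unfolding 0 by (blast intro: route_0)
  next
    case (Suc n')
    from less.prems Suc obtain e f T1 where KT: "K \<subseteq> T" and ef: "step e f T T1" and p1: "path K T1 n'"
      by (auto elim: route.cases)
    note st = stepD[OF ef]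
    have IH: "tame K' U m \<or> shorter U m" if "m \<le> n'" "path K' U m" for m K' U
      using less.IH[of m K' U] that Suc by simp
    have fK: "f \<notin> K" using KT st(4) by blast
    have undone: "insert e (T1 - {f}) = T" by (rule step_back[OF ef])
    have spT: "spanning P T" using tree_spanning[OF st(1)] .
    show ?thesis
    proof (cases "tame K T1 n'")
      case False
      then have "shorter T1 n'" using IH[OF order_refl p1] by blast
      then show ?thesis using shorter_step[OF ef] Suc by blast
    next
      case tame1: True
      consider "\<not> guarded e f" | "guarded e f" "cmp \<longrightarrow> outer f" | "guarded e f" "cmp" "\<not> outer f" by blast
      then show ?thesis
      proof cases
        case 1
        then show ?thesis using tame_or_shorter_step[OF KT ef, of n'] tame1 Suc by simp
      next
        case 2
        then have "outer e" by (auto simp: guarded_def)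
        then have "tame K (insert e (T1 - {f})) (Suc n') \<or> shorter (insert e (T1 - {f})) (Suc n')"
          using tame_hull_flip[OF tame1 IH _ st(8,9) fK 2(2)] spT undone by simp
        then show ?thesis unfolding undone Suc .
      next
        case 3
        have fP: "f \<in> edges_on P" and eP: "e \<in> edges_on P"
          using tree_edges_on st(1-3,9) by blast+
        obtain p0 q0 where f0: "f = {p0, q0}" using fP by (auto simp: edges_on_def)
        have "\<not> crossing e f" using st(6) 3(2) by blast
        then have "e \<subseteq> side P p0 q0 \<or> e \<subseteq> side P q0 p0"
          using noncrossing_side eP fP unfolding f0 by blast
        then obtain p q where f: "f = {p, q}" and e_side: "e \<subseteq> side P q p"
          using f0 by (metis insert_commute)
        have f1: "{p, q} \<in> T1" using st(9) f by simp
        have efne: "e \<noteq> {p, q}" using st(7) f by simp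
        have not_e: "g \<noteq> e" if "g \<subseteq> side P p q" "g \<in> edges_on P" for g
          using edge_both_sides[of g p q] that e_side efne fP f by blast
        from side_first_or_stand_in[OF tame1, of p q] f1 fK f 3(3)
        consider (first) a b T1' m where "n' = Suc m" "step a b T1 T1'" "a \<noteq> {p, q}" "a \<subseteq> side P p q"
            "path (if guarded a b then insert b K else K) T1' m"
          | (stand_in) x m where "m \<le> n'" "outer x" "x \<subseteq> side P p q" "x \<notin> T1"
            "spanning P (insert x (T1 - {{p, q}}))" "path K (insert x (T1 - {{p, q}})) m"
          | (keep) "path (insert {p, q} K) T1 n'" by auto
        then show ?thesis
        proof cases
          case first
          note st' = stepD[OF first(2)]
          have aP: "a \<in> edges_on P" and bP: "b \<in> edges_on P"
            using tree_edges_on st'(1-3,9) by blast+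
          have b_side: "b \<subseteq> side P p q" using step_side[OF first(2) f1 first(3,4)] .
          have be: "b \<noteq> e" and ae: "a \<noteq> e" using not_e[OF b_side bP] not_e[OF first(4) aP] by auto
          have bf: "b \<noteq> f" using st'(4) st(9) by blast
          have aT: "a \<in> T" using st'(3) st(5) first(3) f by simp
          have bT: "b \<notin> T" using st'(4) st(5) be by auto
          let ?T' = "insert b (T - {a})"
          let ?K' = "if guarded a b then insert b K else K"
          have "\<not> spanning P (insert e (T1 - {a}))"
            using opposite_exchange[OF st(2) f1 st'(3) first(3,4) eP st(8) e_side] .
          then have "spanning P (insert b (insert e (T1 - {f}) - {a}))"
            using spanning_double_exchange[OF finite_P tree_spanning[OF st(2)] st'(3) st(9) _ st(8) st'(4) be[symmetric]]
              first(3) f st'(10) spT undone by auto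
          then have sp: "spanning P ?T'" unfolding undone .
          have T': "tree ?T'"
          proof (rule tree_exchange[OF st(1) sp])
            fix g assume g: "g \<in> T" "g \<noteq> a"
            show "\<not> crossing b g"
            proof (cases "g = e")
              case True
              then show ?thesis using opposite_sides_noncrossing[OF bP eP _ b_side e_side] fP f by simp
            next
              case False
              then have "g \<in> T1'" using g st(5) st'(5) by simp
              then show ?thesis using tree_noncrossing[OF st'(2,9)] by blast
            qed
          qed
          have step1: "step a b T ?T'" using st(1) T' aT bT st'(6) by (intro stepI) auto
          have "T1' = insert f (?T' - {e})"
            using st(5) st'(5) ae be bf first(3) f by auto
          then have step2: "step e f ?T' T1'"
            using T' st'(2) st(3,4,6) ae bf by (intro stepI) auto
          have "a \<notin> K" using route_removed[OF first(2,5)] by (auto split: if_splits)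
          then have "?K' \<subseteq> ?T'" using KT by auto
          then have "path ?K' ?T' n'"
            unfolding first(1) by (rule path_Suc[OF _ step2 first(5)])
          then show ?thesis unfolding Suc by (rule tame_or_shorter_step[OF KT step1 IH[OF order_refl]])
        next
          case stand_in
          have xe: "x \<noteq> e" using not_e[OF stand_in(3)] hull_edge_edges_on[OF stand_in(2)] by blast
          then have xT: "x \<notin> T" using stand_in(4) undone by auto
          let ?S = "insert x (T1 - {{p, q}})"
          have S_eq: "?S = insert x (T - {e})" using st(4,5) f by auto
          have S: "tree ?S" using tree_exchange_hull[OF st(2) stand_in(5,2)] .
          have stepS: "step e x T ?S"
            using st(1,3) S S_eq xT hull_edge_noncrossing[OF stand_in(2) eP] by (intro stepI) auto
          show ?thesis
          proof (cases "m = n'")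
            case False
            then have "shorter ?S n'" using shorter_path[OF stand_in(6)] stand_in(1) by simp
            then show ?thesis using shorter_step[OF stepS] Suc by blast
          next
            case True
            then have "path K ?S n'" using stand_in(6) by blast
            then have tame_S: "tame K ?S n' \<or> shorter ?S n'" using IH by blast
            show ?thesis
            proof (cases "outer e \<and> tame K ?S n'")
              case True
              have "insert e (?S - {x}) = T" using S_eq xT st(3) by auto
              moreover have "x \<notin> K" using KT xT by blast
              moreover have "e \<notin> ?S" using xe st(8) by auto
              ultimately show ?thesis
                using tame_hull_flip[of K ?S n' e x, OF conjunct2[OF True] IH] True stand_in(2) spT Suc by simp
            next
              case False
              show ?thesis
              proof (cases "shorter ?S n'")
                case True
                then show ?thesis using shorter_step[OF stepS] Suc by blast
              next
                case no: False
                with False tame_S have "\<not> guarded e x" "tame K ?S n'"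
                  using stand_in(2) by (auto simp: guarded_def)
                then show ?thesis using tame_or_shorter_step[OF KT stepS, of n'] Suc by simp
              qed
            qed
          qed
        next
          case keep
          then have "tame (insert f K) T1 n' \<or> shorter T1 n'" using IH f by blast
          then show ?thesis using tame_or_shorter_step[OF KT ef, of n'] 3(1) Suc by simp
        qed
      qed
    qed
  qed
qed

end

section \<open>Traces\<close>

context flip_problem
begin

lemma step_sym:
  assumes "step a b T T'"
  shows "step b a T' T"
proof -
  note st = stepD[OF assms]
  show ?thesis
    by (rule stepI[OF st(2,1,9,8) step_back[OF assms, symmetric]]) (use st(6) crossing_sym in blast)
qed

lemma hull_tree_exists:
  obtains S where "tree S" and "\<forall>h\<in>S. outer h"
proof -
  let ?m = "\<lambda>T. card {e \<in> T. \<not> outer e}"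
  define T where "T = arg_min ?m tree"
  have T: "tree T" and least: "\<And>T'. tree T' \<Longrightarrow> card {e \<in> T. \<not> outer e} \<le> card {e \<in> T'. \<not> outer e}"
    unfolding T_def by (rule arg_min_natI[of tree, OF tree_TF], rule arg_min_nat_le[of tree _ ?m])
  have "outer f" if f: "f \<in> T" for f
  proof (rule ccontr)
    assume "\<not> outer f"
    obtain p q where pq: "f = {p, q}" using tree_edges_on[OF T f] by (auto simp: edges_on_def)
    then obtain x where x: "outer x" "spanning P (insert x (T - {f}))"
      using hull_gap[OF T, of p q] f \<open>\<not> outer f\<close> by blast
    have "finite T"
      using tree_edges_on[OF T] finite_edges_on[OF finite_P] by (meson finite_subset subsetI)
    moreover have "{e \<in> insert x (T - {f}). \<not> outer e} \<subset> {e \<in> T. \<not> outer e}"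
      using x(1) f \<open>\<not> outer f\<close> by auto
    ultimately have "card {e \<in> insert x (T - {f}). \<not> outer e} < card {e \<in> T. \<not> outer e}"
      by (intro psubset_card_mono) auto
    then show False using least[OF tree_exchange_hull[OF T x(2,1)]] by simp
  qed
  then show ?thesis using that T by blast
qed

lemma reach_hull_tree:
  assumes "tree S" and "\<forall>h\<in>S. outer h" and "tree T"
  shows "(T, S) \<in> {(T, T'). \<exists>a b. step a b T T'}\<^sup>*"
  using assms(3)
proof (induction "card (T - S)" arbitrary: T rule: less_induct)
  case less
  have fin: "finite T" "finite S"
    using tree_edges_on[OF less.prems] tree_edges_on[OF assms(1)] finite_edges_on[OF finite_P]
    by (meson finite_subset subsetI)+
  show ?case
  proof (cases "T \<subseteq> S")
    case True
    have "card T = card S"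
      using tree_spanning[OF less.prems] tree_spanning[OF assms(1)] by (simp add: spanning_def)
    then have "T = S" using card_subset_eq[OF fin(2) True] by blast
    then show ?thesis by simp
  next
    case False
    then obtain a where a: "a \<in> T" "a \<notin> S" by blast
    obtain u v where uv: "a = {u, v}" "u \<in> P" "v \<in> P"
      using tree_edges_on[OF less.prems a(1)] by (auto simp: edges_on_def)
    have "linked S u v"
      using tree_spanning[OF assms(1)] uv by (auto simp: spanning_def connected_graph_linked)
    moreover have "\<not> linked (T - {a}) u v"
      using spanning_remove[OF finite_P tree_spanning[OF less.prems], of u v] a(1) uv(1) by simp
    ultimately obtain c d where cd: "{c, d} \<in> S" "\<not> linked (T - {a}) c d" by (rule linked_witness)
    let ?T' = "insert {c, d} (T - {a})"
    have cdT: "{c, d} \<notin> T" using linked_edge[of c d "T - {a}"] cd a(2) by blast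
    have "{c, d} \<in> edges_on P" using tree_edges_on[OF assms(1) cd(1)] .
    then have "spanning P ?T'"
      using spanning_exchange_iff[OF finite_P tree_spanning[OF less.prems] a(1) _ cdT] cd(2) by blast
    moreover have h: "outer {c, d}" using cd(1) assms(2) by blast
    ultimately have T': "tree ?T'" using tree_exchange_hull[OF less.prems] by blast
    have "step a {c, d} T ?T'"
      using less.prems T' a(1) cdT hull_edge_noncrossing(2)[OF h tree_edges_on[OF less.prems a(1)]]
      by (intro stepI) auto
    moreover have "?T' - S \<subset> T - S" using cd(1) a by auto
    then have "card (?T' - S) < card (T - S)" using fin by (intro psubset_card_mono) auto
    from less.hyps[OF this T'] have "(?T', S) \<in> {(T, T'). \<exists>a b. step a b T T'}\<^sup>*" .
    ultimately show ?thesis by (intro converse_rtrancl_into_rtrancl[of T ?T']) auto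
  qed
qed

lemma path_exists:
  assumes "tree T"
  shows "\<exists>n. path {} T n"
proof -
  let ?R = "{(T, T'). \<exists>a b. step a b T T'}"
  obtain S where S: "tree S" "\<forall>h\<in>S. outer h" by (rule hull_tree_exists)
  have "sym ?R" using step_sym unfolding sym_def by blast
  then have "(S, TF) \<in> ?R\<^sup>*" using reach_hull_tree[OF S tree_TF] by (meson sym_rtrancl symD)
  then have "(T, TF) \<in> ?R\<^sup>*" using reach_hull_tree[OF S assms] by (rule rtrancl_trans[rotated])
  then show ?thesis
  proof (induction rule: converse_rtrancl_induct)
    case base
    then show ?case using route_0[of "{}"] by blast
  next
    case (step T T')
    then show ?case using path_Suc[of "{}" T] by blast
  qed
qed

lemma path_of_list:
  assumes "Ts \<noteq> []" and "last Ts = TF" and "successively (\<lambda>T T'. \<exists>a b. step a b T T') Ts"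
  shows "path {} (hd Ts) (length Ts - 1)"
  using assms
proof (induction Ts rule: induct_list012)
  case (2 T)
  then show ?case using route_0[of "{}"] by simp
next
  case (3 T T' Ts)
  then show ?case using path_Suc[of "{}" T] by auto
qed simp

lemma list_of_tame:
  assumes "tame K T n"
  shows "\<exists>Ts. length Ts = Suc n \<and> hd Ts = T \<and> last Ts = TF \<and>
    successively (\<lambda>T T'. \<exists>a b. step a b T T') Ts \<and> (\<forall>k\<in>K. trace Ts k = [k]) \<and>
    (\<forall>i < length Ts. \<forall>h \<in> Ts ! i. outer h \<longrightarrow> trace_length (drop i Ts) h \<le> 1) \<and>
    (cmp \<longrightarrow> (\<forall>e \<in> T. trace_length Ts e \<le> 2))"
  using assms
proof (induction rule: route.induct)
  case (route_0 K)
  show ?case by (rule exI[of _ "[TF]"]) (simp add: trace_length_def)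
next
  case (route_Suc K T a b T' n)
  note st = stepD[OF route_Suc.hyps(2)]
  let ?K' = "if guarded a b then insert b K else K"
  obtain Ts where Ts: "length Ts = Suc n" "hd Ts = T'" "last Ts = TF"
    "successively (\<lambda>T T'. \<exists>a b. step a b T T') Ts" "\<forall>k\<in>?K'. trace Ts k = [k]"
    "\<forall>i < length Ts. \<forall>h \<in> Ts ! i. outer h \<longrightarrow> trace_length (drop i Ts) h \<le> 1"
    "cmp \<longrightarrow> (\<forall>e \<in> T'. trace_length Ts e \<le> 2)"
    using route_Suc.IH by blast
  from Ts(1,2) obtain Us where Us: "Ts = T' # Us" by (cases Ts) auto
  have new: "T' - T = {b}" using st(4,5) by blast
  have tr: "trace (T # Ts) e = (if e = a then a # trace Ts b else trace Ts e)" if "e \<in> T" for e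
    using that st(5,8) new by (auto simp: Us)
  have K: "trace (T # Ts) k = [k]" if "k \<in> K" for k
    using tr[of k] that route_Suc.hyps(1) route_removed[OF route_Suc.hyps(2,3)] Ts(5)
    by (auto split: if_splits)
  have head: "trace_length Ts h \<le> 1" if "h \<in> T'" "outer h" for h
    using Ts(6) that by (auto simp: Us)
  have hull: "trace_length (T # Ts) h \<le> 1" if h: "h \<in> T" "outer h" for h
  proof (cases "h = a")
    case True
    then have "trace Ts b = [b]" using h Ts(5) by (simp add: guarded_def)
    then show ?thesis using tr[OF h(1)] True by (simp add: trace_length_def)
  next
    case False
    then have "h \<in> T'" using h st(5) by simp
    then show ?thesis using tr[OF h(1)] False head h(2) by (simp add: trace_length_def)
  qed
  have all: "trace_length (T # Ts) e \<le> 2" if e: "e \<in> T" "cmp" for e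
  proof (cases "e = a")
    case True
    have "length (trace Ts b) \<le> 2"
    proof (cases "outer b")
      case True
      then show ?thesis using head[OF st(9)] by (simp add: trace_length_def)
    next
      case False
      then have "guarded a b" unfolding guarded_def using e(2) by blast
      then show ?thesis using Ts(5) by simp
    qed
    then show ?thesis using tr[OF e(1)] True by (simp add: trace_length_def)
  next
    case False
    then have "e \<in> T'" using e st(5) by simp
    then show ?thesis using tr[OF e(1)] False Ts(7) e(2) by (simp add: trace_length_def)
  qed
  have "trace_length (drop i (T # Ts)) h \<le> 1" if "i < length (T # Ts)" "h \<in> (T # Ts) ! i" "outer h" for i h
    using that hull Ts(6) by (cases i) auto
  then show ?case
    using Ts(1-4) K all route_Suc.hyps(2) Us
    by (intro exI[of _ "T # Ts"]) auto
qed

lemma shortest_list: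
  assumes "tree T"
  shows "\<exists>Ts. hd Ts = T \<and> last Ts = TF \<and> Ts \<noteq> [] \<and>
    successively (\<lambda>T T'. \<exists>a b. step a b T T') Ts \<and>
    (\<forall>Us. Us \<noteq> [] \<longrightarrow> hd Us = T \<longrightarrow> last Us = TF \<longrightarrow>
      successively (\<lambda>T T'. \<exists>a b. step a b T T') Us \<longrightarrow> seq_length Ts \<le> seq_length Us) \<and>
    (\<forall>i < length Ts. \<forall>h \<in> Ts ! i. outer h \<longrightarrow> trace_length (drop i Ts) h \<le> 1) \<and>
    (cmp \<longrightarrow> (\<forall>e \<in> T. trace_length Ts e \<le> 2))"
proof -
  define n where "n = (LEAST n. path {} T n)"
  have n: "path {} T n" and least: "\<And>m. path {} T m \<Longrightarrow> n \<le> m"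
    using path_exists[OF assms] unfolding n_def by (auto intro: LeastI Least_le)
  have "\<not> shorter T n" using least by (force simp: shorter_def)
  then have "tame {} T n" using path_tame[OF n] by blast
  then obtain Ts where Ts: "length Ts = Suc n" "hd Ts = T" "last Ts = TF"
    "successively (\<lambda>T T'. \<exists>a b. step a b T T') Ts"
    "\<forall>i < length Ts. \<forall>h \<in> Ts ! i. outer h \<longrightarrow> trace_length (drop i Ts) h \<le> 1"
    "cmp \<longrightarrow> (\<forall>e \<in> T. trace_length Ts e \<le> 2)"
    using list_of_tame by blast
  have "seq_length Ts \<le> seq_length Us"
    if "Us \<noteq> []" "hd Us = T" "last Us = TF" "successively (\<lambda>T T'. \<exists>a b. step a b T T') Us" for Us
    using least[of "length Us - 1"] path_of_list[OF that(1,3,4)] that(2) Ts(1)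
    by (simp add: seq_length_def)
  then show ?thesis using Ts by (intro exI[of _ Ts]) auto
qed

end

lemma successively_trees:
  assumes "successively (\<lambda>T T'. \<exists>e f. flip P e f T T') Ts" and "Ts \<noteq> []" and "plane_spanning_tree P (hd Ts)"
  shows "\<forall>T\<in>set Ts. plane_spanning_tree P T"
  using assms
proof (induction Ts rule: induct_list012)
  case (3 T T' Ts)
  from "3.prems"(1) obtain e f where "flip P e f T T'" unfolding successively.simps by blast
  then have "plane_spanning_tree P T'" unfolding flip_def by blast
  moreover have "successively (\<lambda>T T'. \<exists>e f. flip P e f T T') (T' # Ts)" using "3.prems"(1) by simp
  ultimately have "\<forall>U\<in>set (T' # Ts). plane_spanning_tree P U" using "3.IH"(2) by simp
  then show ?case using "3.prems"(3) by simp
qed simp_all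

theorem theorem5:
  fixes P :: "(real^2) set" and T\<^sub>I T\<^sub>F :: "(real^2) set set"
  assumes "finite P" and "convex_position P"
    and "plane_spanning_tree P T\<^sub>I" and "plane_spanning_tree P T\<^sub>F"
  shows "(\<exists>Ts. shortest_flip_sequence P T\<^sub>I T\<^sub>F Ts \<and>
            (\<forall>i < length Ts. \<forall>h \<in> Ts ! i. hull_edge P h \<longrightarrow> trace_length (drop i Ts) h \<le> 1))
       \<and> (\<exists>Ts. shortest_compatible_flip_sequence P T\<^sub>I T\<^sub>F Ts \<and>
            (\<forall>e \<in> T\<^sub>I. trace_length Ts e \<le> 2))"
proof
  interpret any: flip_problem P False "T\<^sub>F" using assms by unfold_locales auto
  have step: "any.step a b = flip P a b" for a b
    by (intro ext) (simp add: any.step_def)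
  have seq: "flip_sequence P T\<^sub>I T\<^sub>F Us \<longleftrightarrow> Us \<noteq> [] \<and> hd Us = T\<^sub>I \<and> last Us = T\<^sub>F \<and>
      successively (\<lambda>T T'. \<exists>e f. flip P e f T T') Us" for Us
    using successively_trees[of P Us] assms(3) by (auto simp: flip_sequence_def)
  show "\<exists>Ts. shortest_flip_sequence P T\<^sub>I T\<^sub>F Ts \<and>
      (\<forall>i < length Ts. \<forall>h \<in> Ts ! i. hull_edge P h \<longrightarrow> trace_length (drop i Ts) h \<le> 1)"
  proof -
    obtain Ts where "hd Ts = T\<^sub>I \<and> last Ts = T\<^sub>F \<and> Ts \<noteq> [] \<and>
      successively (\<lambda>T T'. \<exists>e f. flip P e f T T') Ts \<and>
      (\<forall>Us. Us \<noteq> [] \<longrightarrow> hd Us = T\<^sub>I \<longrightarrow> last Us = T\<^sub>F \<longrightarrow>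
        successively (\<lambda>T T'. \<exists>e f. flip P e f T T') Us \<longrightarrow> seq_length Ts \<le> seq_length Us) \<and>
      (\<forall>i < length Ts. \<forall>h \<in> Ts ! i. hull_edge P h \<longrightarrow> trace_length (drop i Ts) h \<le> 1)"
      using any.shortest_list[OF assms(3)] unfolding step by (elim exE conjE) (rule that, intro conjI)
    then show ?thesis
      unfolding shortest_flip_sequence_def is_arg_min_linorder seq by (intro exI[of _ Ts]) simp
  qed
next
  interpret compat: flip_problem P True "T\<^sub>F" using assms by unfold_locales auto
  have step: "compat.step a b = compatible_flip P a b" for a b
    by (intro ext) (simp add: compat.step_def compatible_flip_def)
  have weaken: "successively (\<lambda>T T'. \<exists>e f. flip P e f T T') Us"
    if "successively (\<lambda>T T'. \<exists>e f. compatible_flip P e f T T') Us" for Us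
    using that by (rule successively_mono) (auto simp: compatible_flip_def)
  have seq: "compatible_flip_sequence P T\<^sub>I T\<^sub>F Us \<longleftrightarrow> Us \<noteq> [] \<and> hd Us = T\<^sub>I \<and> last Us = T\<^sub>F \<and>
      successively (\<lambda>T T'. \<exists>e f. compatible_flip P e f T T') Us" for Us
    using successively_trees[OF weaken] weaken assms(3)
    by (auto simp: compatible_flip_sequence_def flip_sequence_def)
  show "\<exists>Ts. shortest_compatible_flip_sequence P T\<^sub>I T\<^sub>F Ts \<and> (\<forall>e \<in> T\<^sub>I. trace_length Ts e \<le> 2)"
  proof -
    obtain Ts where "hd Ts = T\<^sub>I \<and> last Ts = T\<^sub>F \<and> Ts \<noteq> [] \<and>
      successively (\<lambda>T T'. \<exists>e f. compatible_flip P e f T T') Ts \<and>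
      (\<forall>Us. Us \<noteq> [] \<longrightarrow> hd Us = T\<^sub>I \<longrightarrow> last Us = T\<^sub>F \<longrightarrow>
        successively (\<lambda>T T'. \<exists>e f. compatible_flip P e f T T') Us \<longrightarrow>
        seq_length Ts \<le> seq_length Us) \<and> (\<forall>e \<in> T\<^sub>I. trace_length Ts e \<le> 2)"
      using compat.shortest_list[OF assms(3)] unfolding step by (elim exE conjE) (rule that, simp)
    then show ?thesis
      unfolding shortest_compatible_flip_sequence_def is_arg_min_linorder seq by (intro exI[of _ Ts]) simp
  qed
qed

end
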